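(* For every integer $n\ge2$, the polynomial $S_n$ is a solution of the second-order linear differential equation with polynomial coefficients $$\mathcal P_{2,n}(x)S_n''(x)+\mathcal P_{1,n}(x)S_n'(x)+\mathcal P_{0,n}(x)S_n(x)=0,$$ where \begin{align*} \mathcal P_{2,n}&=q_{1,n}\,q_{0,n}^2,\\ \mathcal P_{1,n}&=q_{0,n}\left(q_{1,n}q_{2,n}+q_{1,n}q_{3,n}+q_{0,n}'q_{1,n}-q_{0,n}q_{1,n}'\right),\\ \mathcal P_{0,n}&=q_{1,n}q_{2,n}q_{3,n}+q_{0,n}\left(q_{2,n}'q_{1,n}-q_{2,n}q_{1,n}'\right)-q_{4,n}q_{1,n}^2, \end{align*} and \begin{align*} \mathrm{DgCo}(\mathcal P_{2,n})&=\left(6d+2,\,(\gamma_n+\sigma_n)\left(1+\tfrac{\sigma_{n-1}}{\gamma_{n-1}}\right)^2\right),\\ \mathrm{DgCo}(\mathcal P_{1,n})&=\left(6d+2,\,-(\gamma_n+\sigma_n)\left(1+\tfrac{\sigma_{n-1}}{\gamma_{n-1}}\right)^2\right),\\ \mathrm{DgCo}(\mathcal P_{0,n})&=\left(6d+1,\,n(\gamma_n+\sigma_n)\left(1+\tfrac{\sigma_{n-1}}{\gamma_{n-1}}\right)^2\right). \end{align*}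
   Context: Setting. Let $\alpha>-1$, $N\ge 1$, let $c_1,\dots,c_N\in(-\infty,0)$ be distinct, let $0\le d_1\le\cdots\le d_N$ be integers, and let $\lambda_{j,k}\ge 0$ for $1\le j\le N$, $0\le k\le d_j$, with $\lambda_{j,d_j}>0$ for every $j$. Put $I_+=\{(j,k):\lambda_{j,k}>0\}$. On real polynomials define $$\langle f,g\rangle_{\mathsf s}=\int_0^{+\infty}f(x)g(x)x^\alpha e^{-x}\,dx+\sum_{(j,k)\in I_+}\lambda_{j,k}f^{(k)}(c_j)g^{(k)}(c_j).$$ $S_n$ is the monic polynomial of degree $n$ with $\langle S_n,x^k\rangle_{\mathsf s}=0$ for $k=0,\dots,n-1$ (it exists and is unique). $L_n^\alpha$ is the monic Laguerre polynomial of degree $n$, orthogonal with respect to $x^\alpha e^{-x}dx$ on $(0,+\infty)$. Notation. $h_n^\alpha=n!\,\Gamma(n+\alpha+1)$, $\gamma_n=n(n+\alpha)$, $\beta_n=2n+\alpha+1$. $T_k(x,y;f)=\sum_{\nu=0}^k\frac{f^{(\nu)}(y)}{\nu!}(x-y)^\nu$. $\rho(x)=\prod_{j=1}^N(x-c_j)^{d_j+1}$, $d=\sum_{j=1}^N(d_j+1)=\deg\rho$, and $\rho_{j,k}(x)=\rho(x)/(x-c_j)^{k+1}$. For a polynomial $p$ of degree $m$ with leading coefficient $a$, $\mathrm{DgCo}(p)=(m,a)$. For $n\ge 1$: $$\sigma_n=\frac1{h^\alpha_{n-1}}\sum_{(j,k)\in I_+}\lambda_{j,k}S_n^{(k)}(c_j)(L_n^\alpha)^{(k)}(c_j),$$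 $$F_{2,n}(x)=\rho(x)-\sum_{(j,k)\in I_+}\frac{k!\,\lambda_{j,k}S_n^{(k)}(c_j)}{h^\alpha_{n-1}}T_k(x,c_j;L^\alpha_{n-1})\rho_{j,k}(x),$$ $$G_{2,n}(x)=\sum_{(j,k)\in I_+}\frac{k!\,\lambda_{j,k}S_n^{(k)}(c_j)}{h^\alpha_{n-1}}T_k(x,c_j;L^\alpha_{n})\rho_{j,k}(x),$$ $$F_{3,n}(x)=xF_{2,n}'(x)+nF_{2,n}(x)-G_{2,n}(x),\qquad G_{3,n}(x)=xG_{2,n}'(x)+\gamma_nF_{2,n}(x)-(n+\alpha-x)G_{2,n}(x).$$ For $n\ge2$ and $i\in\{2,3\}$: $$V_{i,n}(x)=-\frac{G_{i,n-1}(x)}{\gamma_{n-1}},\qquad W_{i,n}(x)=F_{i,n-1}(x)+G_{i,n-1}(x)\,\frac{x-\beta_{n-1}}{\gamma_{n-1}},$$ $$\Delta_n(x)=F_{2,n}(x)W_{2,n}(x)-V_{2,n}(x)G_{2,n}(x),\qquad \delta_n(x)=\frac{\Delta_n(x)}{\rho(x)},$$ where $\rho$ divides $\Delta_n$, so that $\delta_n$ is a polynomial. Finally, for $n\ge 2$: \begin{align*} q_{0,n}(x)&=x\Delta_n(x),\\ q_{1,n}(x)&=G_{3,n}(x)F_{2,n}(x)-F_{3,n}(x)G_{2,n}(x),\\ q_{2,n}(x)&=x\rho'(x)\delta_n(x)+G_{3,n}(x)V_{2,n}(x)-F_{3,n}(x)W_{2,n}(x),\\ q_{3,n}(x)&=x\rho'(x)\delta_n(x)+V_{3,n}(x)G_{2,n}(x)-W_{3,n}(x)F_{2,n}(x),\\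 q_{4,n}(x)&=V_{3,n}(x)W_{2,n}(x)-W_{3,n}(x)V_{2,n}(x). \end{align*} *)

theory Defs
  imports "HOL-Analysis.Analysis" "HOL-Computational_Algebra.Polynomial"
begin

text \<open>
  A definite description: for a bilinear form that is positive definite on polynomials,
  such as the two used below, exactly one polynomial satisfies it.
\<close>

definition monic_orthogonal_poly ::
  "(real poly \<Rightarrow> real poly \<Rightarrow> real) \<Rightarrow> nat \<Rightarrow> real poly" where
  "monic_orthogonal_poly B n =
     (THE p. degree p = n \<and> lead_coeff p = 1 \<and> (\<forall>k<n. B p (monom 1 k) = 0))"

definition laguerre_product :: "real \<Rightarrow> real poly \<Rightarrow> real poly \<Rightarrow> real" where
  "laguerre_product \<alpha> f g =
     (LBINT x:{0<..}. poly f x * poly g x * (x powr \<alpha> * exp (- x)))"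

definition laguerre :: "real \<Rightarrow> nat \<Rightarrow> real poly" where
  "laguerre \<alpha> = monic_orthogonal_poly (laguerre_product \<alpha>)"

definition h :: "real \<Rightarrow> nat \<Rightarrow> real" where
  "h \<alpha> n = fact n * Gamma (real n + \<alpha> + 1)"

definition \<gamma> :: "real \<Rightarrow> nat \<Rightarrow> real" where
  "\<gamma> \<alpha> n = real n * (real n + \<alpha>)"

definition \<beta> :: "real \<Rightarrow> nat \<Rightarrow> real" where
  "\<beta> \<alpha> n = 2 * real n + \<alpha> + 1"

definition deriv_at :: "nat \<Rightarrow> real poly \<Rightarrow> real \<Rightarrow> real" where
  "deriv_at k f y = poly ((pderiv ^^ k) f) y"

definition taylor_poly :: "nat \<Rightarrow> real \<Rightarrow> real poly \<Rightarrow> real poly" where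
  "taylor_poly k y f = (\<Sum>\<nu>\<le>k. smult (deriv_at \<nu> f y / fact \<nu>) ([:- y, 1:] ^ \<nu>))"

definition DgCo :: "real poly \<Rightarrow> nat \<times> real" where
  "DgCo p = (degree p, lead_coeff p)"

text \<open>
  The points \<open>c j\<close>, the orders \<open>d j\<close> and the weights \<open>lam j k\<close> are only relevant for
  \<open>1 \<le> j \<le> N\<close> and \<open>k \<le> d j\<close>; every definition below uses them only in this range.
  Outside the context each constant takes those of the parameters
  \<open>\<alpha> N c d lam\<close> on which it depends, in this order, as its first arguments.
\<close>

context
  fixes \<alpha> :: real and N :: nat and c :: "nat \<Rightarrow> real" and d :: "nat \<Rightarrow> nat"
    and lam :: "nat \<Rightarrow> nat \<Rightarrow> real"
begin

definition I_plus :: "(nat \<times> nat) set" where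
  "I_plus = {(j, k). 1 \<le> j \<and> j \<le> N \<and> k \<le> d j \<and> lam j k > 0}"

definition sobolev_product :: "real poly \<Rightarrow> real poly \<Rightarrow> real" where
  "sobolev_product f g =
     laguerre_product \<alpha> f g
     + (\<Sum>(j, k)\<in>I_plus. lam j k * deriv_at k f (c j) * deriv_at k g (c j))"

definition S :: "nat \<Rightarrow> real poly" where
  "S = monic_orthogonal_poly sobolev_product"

definition rho :: "real poly" where
  "rho = (\<Prod>j=1..N. [:- c j, 1:] ^ (d j + 1))"

definition deg_rho :: nat where
  "deg_rho = (\<Sum>j=1..N. d j + 1)"

text \<open>The division is exact for \<open>1 \<le> j \<le> N\<close> and \<open>k \<le> d j\<close>.\<close>

definition rho_quot :: "nat \<Rightarrow> nat \<Rightarrow> real poly" where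
  "rho_quot j k = rho div [:- c j, 1:] ^ (k + 1)"

definition \<sigma> :: "nat \<Rightarrow> real" where
  "\<sigma> n =
     (1 / h \<alpha> (n - 1)) *
     (\<Sum>(j, k)\<in>I_plus. lam j k * deriv_at k (S n) (c j) * deriv_at k (laguerre \<alpha> n) (c j))"

definition F2 :: "nat \<Rightarrow> real poly" where
  "F2 n = rho -
     (\<Sum>(j, k)\<in>I_plus.
        smult (fact k * lam j k * deriv_at k (S n) (c j) / h \<alpha> (n - 1))
          (taylor_poly k (c j) (laguerre \<alpha> (n - 1)) * rho_quot j k))"

definition G2 :: "nat \<Rightarrow> real poly" where
  "G2 n =
     (\<Sum>(j, k)\<in>I_plus.
        smult (fact k * lam j k * deriv_at k (S n) (c j) / h \<alpha> (n - 1))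
          (taylor_poly k (c j) (laguerre \<alpha> n) * rho_quot j k))"

definition F3 :: "nat \<Rightarrow> real poly" where
  "F3 n = [:0, 1:] * pderiv (F2 n) + smult (real n) (F2 n) - G2 n"

definition G3 :: "nat \<Rightarrow> real poly" where
  "G3 n = [:0, 1:] * pderiv (G2 n) + smult (\<gamma> \<alpha> n) (F2 n) - [:real n + \<alpha>, -1:] * G2 n"

definition V2 :: "nat \<Rightarrow> real poly" where
  "V2 n = - smult (1 / \<gamma> \<alpha> (n - 1)) (G2 (n - 1))"

definition V3 :: "nat \<Rightarrow> real poly" where
  "V3 n = - smult (1 / \<gamma> \<alpha> (n - 1)) (G3 (n - 1))"

definition W2 :: "nat \<Rightarrow> real poly" where
  "W2 n = F2 (n - 1) + G2 (n - 1) * smult (1 / \<gamma> \<alpha> (n - 1)) [:- \<beta> \<alpha> (n - 1), 1:]"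

definition W3 :: "nat \<Rightarrow> real poly" where
  "W3 n = F3 (n - 1) + G3 (n - 1) * smult (1 / \<gamma> \<alpha> (n - 1)) [:- \<beta> \<alpha> (n - 1), 1:]"

definition Delta :: "nat \<Rightarrow> real poly" where
  "Delta n = F2 n * W2 n - V2 n * G2 n"

text \<open>For \<open>n \<ge> 2\<close> the polynomial \<open>rho\<close> divides \<open>Delta n\<close>, so this is the exact quotient.\<close>

definition delta :: "nat \<Rightarrow> real poly" where
  "delta n = Delta n div rho"

definition q0 :: "nat \<Rightarrow> real poly" where
  "q0 n = [:0, 1:] * Delta n"

definition q1 :: "nat \<Rightarrow> real poly" where
  "q1 n = G3 n * F2 n - F3 n * G2 n"

definition q2 :: "nat \<Rightarrow> real poly" where
  "q2 n = [:0, 1:] * pderiv rho * delta n + G3 n * V2 n - F3 n * W2 n"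

definition q3 :: "nat \<Rightarrow> real poly" where
  "q3 n = [:0, 1:] * pderiv rho * delta n + V3 n * G2 n - W3 n * F2 n"

definition q4 :: "nat \<Rightarrow> real poly" where
  "q4 n = V3 n * W2 n - W3 n * V2 n"

definition P2 :: "nat \<Rightarrow> real poly" where
  "P2 n = q1 n * q0 n ^ 2"

definition P1 :: "nat \<Rightarrow> real poly" where
  "P1 n = q0 n * (q1 n * q2 n + q1 n * q3 n + pderiv (q0 n) * q1 n - q0 n * pderiv (q1 n))"

definition P0 :: "nat \<Rightarrow> real poly" where
  "P0 n = q1 n * q2 n * q3 n
     + q0 n * (pderiv (q2 n) * q1 n - q2 n * pderiv (q1 n)) - q4 n * q1 n ^ 2"

end

end

theory Submission
  imports Defs
begin

text \<open>
  Expanding \<open>S\<^sub>n - L\<^sub>n\<close> in the Laguerre basis and applying the Christoffel--Darboux formula gives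
  \<open>\<rho> S\<^sub>n = F\<^sub>2 L\<^sub>n + G\<^sub>2 L\<^sub>n\<^sub>-\<^sub>1\<close>. The structure relation of the Laguerre polynomials turns \<open>x (\<rho> S\<^sub>n)'\<close> into
  \<open>F\<^sub>3 L\<^sub>n + G\<^sub>3 L\<^sub>n\<^sub>-\<^sub>1\<close>, and the three-term recurrence gives the analogous formulas for \<open>S\<^sub>n\<^sub>-\<^sub>1\<close> with
  coefficients \<open>V\<close>, \<open>W\<close>. Eliminating \<open>L\<^sub>n\<close>, \<open>L\<^sub>n\<^sub>-\<^sub>1\<close> yields two ladder equations between \<open>S\<^sub>n\<close> and
  \<open>S\<^sub>n\<^sub>-\<^sub>1\<close>, and eliminating \<open>S\<^sub>n\<^sub>-\<^sub>1\<close> yields the differential equation. No leading coefficient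
  vanishes, because \<open>\<gamma>\<^sub>n + \<sigma>\<^sub>n = \<langle>S\<^sub>n, S\<^sub>n\<rangle> / h\<^sub>n\<^sub>-\<^sub>1 > 0\<close>.
\<close>

section \<open>Orthogonal polynomials for a positive definite form\<close>

text \<open>The leading terms cancel. The condition \<open>p \<noteq> q\<close> matters for
  \<open>n = 0\<close>, since the zero polynomial has degree 0.\<close>

lemma degree_diff_less_same_lead:
  fixes p q :: "'a :: ab_group_add poly"
  assumes "degree p = n" "degree q = n" "lead_coeff p = lead_coeff q" "p \<noteq> q"
  shows "degree (p - q) < n"
proof -
  have le: "degree (p - q) \<le> n" using degree_diff_le[of p n q] assms by simp
  moreover have "coeff (p - q) n = 0" using assms by simp
  ultimately show ?thesis
    using assms(4) by (metis eq_iff_diff_eq_0 leading_coeff_0_iff order_le_imp_less_or_eq)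
qed

text \<open>Interpreted for both the Laguerre and the Sobolev product, so that existence, uniqueness
  and expansions are proved once.\<close>

locale poly_inner_product =
  fixes B :: "real poly \<Rightarrow> real poly \<Rightarrow> real"
  assumes add_left: "B (p + q) r = B p r + B q r"
    and smult_left: "B (smult a p) q = a * B p q"
    and commute: "B p q = B q p"
    and pos: "p \<noteq> 0 \<Longrightarrow> B p p > 0"
begin

lemma add_right: "B r (p + q) = B r p + B r q"
  using add_left commute by metis

lemma smult_right: "B q (smult a p) = a * B q p"
  using smult_left commute by metis

lemma zero_left [simp]: "B 0 p = 0"
  using smult_left[of 0 0 p] by simp

lemma zero_right [simp]: "B p 0 = 0"
  using commute[of p 0] by simp

lemma diff_left: "B (p - q) r = B p r - B q r"
  using add_left[of "p - q" q r] by simp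

lemma diff_right: "B r (p - q) = B r p - B r q"
  using diff_left commute by metis

lemma sum_left: "B (\<Sum>i\<in>A. f i) r = (\<Sum>i\<in>A. B (f i) r)"
  by (induction A rule: infinite_finite_induct) (auto simp: add_left)

lemma eq_zeroI: "B p p = 0 \<Longrightarrow> p = 0"
  using pos[of p] by force

text \<open>The monic \<open>Q j\<close> with \<open>j < m\<close> span all polynomials of degree
  below \<open>m\<close>: subtracting a multiple of \<open>Q j\<close> removes the leading term of
  \<open>q\<close>. It serves both for monomials and for the orthogonal polynomials
  themselves.\<close>

lemma orthogonal_lower_degree:
  assumes Q: "\<And>j. j < m \<Longrightarrow> degree (Q j) = j \<and> lead_coeff (Q j) = 1 \<and> B p (Q j) = 0"
    and q: "q = 0 \<or> degree q < m"
  shows "B p q = 0"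
  using q
proof (induction "degree q" arbitrary: q rule: less_induct)
  case less
  show ?case
  proof (cases "q = 0")
    case False
    define j where "j = degree q"
    define r where "r = q - smult (lead_coeff q) (Q j)"
    have j: "j < m" using less.prems False by (auto simp: j_def)
    have dj: "degree (smult (lead_coeff q) (Q j)) = j"
      using Q[OF j] False by simp
    have "lead_coeff (smult (lead_coeff q) (Q j)) = lead_coeff q"
      using Q[OF j] by (metis lead_coeff_smult mult.right_neutral)
    then have "r = 0 \<or> degree r < j"
      using degree_diff_less_same_lead[of q j "smult (lead_coeff q) (Q j)"] dj
      by (auto simp: r_def j_def)
    then have "B p r = 0"
      using less.hyps[of r] j by (auto simp: j_def)
    moreover have "q = r + smult (lead_coeff q) (Q j)" by (simp add: r_def)
    ultimately show ?thesis
      using Q[OF j] by (metis add_right smult_right mult_zero_right add_0)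
  qed simp
qed

definition is_op :: "nat \<Rightarrow> real poly \<Rightarrow> bool" where
  "is_op n p \<longleftrightarrow> degree p = n \<and> lead_coeff p = 1 \<and> (\<forall>k<n. B p (monom 1 k) = 0)"

lemma is_op_orthogonal:
  assumes "is_op n p" "q = 0 \<or> degree q < n"
  shows "B p q = 0"
  by (rule orthogonal_lower_degree[of n "monom 1" p q])
     (use assms in \<open>auto simp: is_op_def degree_monom_eq\<close>)

text \<open>The difference has degree below \<open>n\<close>, so it is orthogonal to
  \<open>p\<close> and \<open>q\<close> and hence to itself.\<close>

lemma is_op_unique:
  assumes "is_op n p" "is_op n q"
  shows "p = q"
proof (rule ccontr)
  assume "p \<noteq> q"
  then have "degree (p - q) < n"
    using assms by (intro degree_diff_less_same_lead) (auto simp: is_op_def)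
  then have "B (p - q) (p - q) = 0"
    using assms is_op_orthogonal by (simp add: diff_left)
  with \<open>p \<noteq> q\<close> show False using eq_zeroI by force
qed

lemma monic_orthogonal_poly_eqI: "is_op n p \<Longrightarrow> monic_orthogonal_poly B n = p"
  unfolding monic_orthogonal_poly_def is_op_def[symmetric]
  by (rule the_equality) (auto intro: is_op_unique)

abbreviation P where "P \<equiv> monic_orthogonal_poly B"

text \<open>Existence by the Gram-Schmidt process; the induction hypothesis says that the definite
  descriptions of smaller index are already the intended polynomials.\<close>

lemma is_op_P: "is_op n (P n)"
proof (induction n rule: less_induct)
  case (less n)
  \<comment> \<open>The orthogonal projection of \<open>monom 1 n\<close> onto the span of the
    earlier \<open>P i\<close>.\<close>
  define r where "r = (\<Sum>i<n. smult (B (monom 1 n) (P i) / B (P i) (P i)) (P i))"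
  define p where "p = monom 1 n - r"
  have "degree (monom 1 n - p) < n \<or> r = 0"
  proof (cases n)
    case (Suc m)
    have "degree r \<le> m" unfolding r_def
      by (intro degree_sum_le order.trans[OF degree_smult_le])
         (use less Suc in \<open>auto simp: is_op_def\<close>)
    then show ?thesis using Suc by (simp add: p_def)
  qed (simp add: r_def)
  then have dr: "degree r < n \<or> r = 0" by (simp add: p_def)
  then have cr: "coeff r n = 0" by (auto simp: coeff_eq_0)
  have "degree p \<le> n" unfolding p_def
    using dr by (intro degree_diff_le) (auto simp: degree_monom_eq)
  moreover have "coeff p n = 1" using cr by (simp add: p_def)
  ultimately have dp: "degree p = n" "lead_coeff p = 1"
    by (metis le_antisym le_degree zero_neq_one)+
  have "B p (P j) = 0" if j: "j < n" for j
  proof -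
    have ne: "P j \<noteq> 0" using less[OF j] by (auto simp: is_op_def)
    have orth: "B (P i) (P j) = 0" if "i < n" "i \<noteq> j" for i
      using is_op_orthogonal[OF less[OF \<open>i < n\<close>], of "P j"]
        is_op_orthogonal[OF less[OF \<open>j < n\<close>], of "P i"] that
        less[OF \<open>i < n\<close>] less[OF \<open>j < n\<close>] commute
      by (metis is_op_def nat_neq_iff)
    have "B r (P j) = (\<Sum>i<n. B (monom 1 n) (P i) / B (P i) (P i) * B (P i) (P j))"
      by (simp add: r_def sum_left smult_left)
    also have "\<dots> = (\<Sum>i<n. if i = j then B (monom 1 n) (P j) else 0)"
      using pos[OF ne] by (intro sum.cong) (auto simp: orth)
    also have "\<dots> = B (monom 1 n) (P j)" using j by simp
    finally show ?thesis by (simp add: p_def diff_left)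
  qed
  \<comment> \<open>Orthogonality to the \<open>P j\<close> is traded for orthogonality to the
    monomials that \<open>is_op\<close> asks for.\<close>
  then have "B p q = 0" if "degree q < n" for q
    using orthogonal_lower_degree[of n P p q] less that unfolding is_op_def by blast
  then have "is_op n p" using dp by (auto simp: is_op_def degree_monom_eq)
  then show ?case using monic_orthogonal_poly_eqI by metis
qed

lemma degree_P [simp]: "degree (P n) = n"
  and coeff_P_self [simp]: "coeff (P n) n = 1"
  using is_op_P[of n] by (auto simp: is_op_def)

lemma P_nonzero [simp]: "P n \<noteq> 0"
  using coeff_P_self[of n] by force

lemma P_orthogonal: "q = 0 \<or> degree q < n \<Longrightarrow> B (P n) q = 0"
  using is_op_orthogonal[OF is_op_P] .

lemma P_orthogonal': "q = 0 \<or> degree q < n \<Longrightarrow> B q (P n) = 0"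
  using P_orthogonal commute by metis

lemma P_0 [simp]: "P 0 = 1"
  by (rule monic_orthogonal_poly_eqI) (simp add: is_op_def)

lemma norm_P_pos: "B (P n) (P n) > 0"
  by (rule pos) simp

text \<open>The remainder has degree below \<open>n\<close> and is orthogonal to every
  \<open>P j\<close> with \<open>j < n\<close>, hence to itself.\<close>

lemma expansion:
  assumes "p = 0 \<or> degree p < n"
  shows "p = (\<Sum>i<n. smult (B p (P i) / B (P i) (P i)) (P i))"
proof -
  define r where "r = (\<Sum>i<n. smult (B p (P i) / B (P i) (P i)) (P i))"
  have "B (p - r) (P j) = 0" if j: "j < n" for j
  proof -
    have "B r (P j) = (\<Sum>i<n. B p (P i) / B (P i) (P i) * B (P i) (P j))"
      by (simp add: r_def sum_left smult_left)
    also have "\<dots> = (\<Sum>i<n. if i = j then B p (P j) else 0)"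
      using norm_P_pos[of j]
      by (intro sum.cong) (auto dest!: nat_neq_iff[THEN iffD1] simp: P_orthogonal P_orthogonal')
    also have "\<dots> = B p (P j)" using j by simp
    finally show ?thesis by (simp add: diff_left)
  qed
  then have *: "B (p - r) q = 0" if "q = 0 \<or> degree q < n" for q
    by (intro orthogonal_lower_degree[of n P]) (use that in auto)
  have "p - r = 0 \<or> degree (p - r) < n"
  proof (cases n)
    case (Suc m)
    have "degree r \<le> m" unfolding r_def
      by (intro degree_sum_le order.trans[OF degree_smult_le])
         (use Suc in auto)
    then have "degree (p - r) \<le> m" using assms Suc by (intro degree_diff_le) auto
    then show ?thesis using Suc by simp
  qed (use assms in \<open>simp add: r_def\<close>)
  then have "B (p - r) (p - r) = 0" by (rule *)
  then show ?thesis using eq_zeroI[of "p - r"] by (simp add: r_def)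
qed

lemma inner_P_monic:
  assumes "degree p = n" "lead_coeff p = 1"
  shows "B (P n) p = B (P n) (P n)"
proof -
  have "p - P n = 0 \<or> degree (p - P n) < n"
    using degree_diff_less_same_lead[of p n "P n"] assms by auto
  then have "B (P n) (p - P n) = 0" by (rule P_orthogonal)
  then show ?thesis by (simp add: diff_right)
qed

end

section \<open>Derivatives at a point and Taylor polynomials\<close>

lemma deriv_at_add: "deriv_at k (p + q) y = deriv_at k p y + deriv_at k q y"
  by (simp add: deriv_at_def higher_pderiv_add)

lemma deriv_at_smult: "deriv_at k (smult a p) y = a * deriv_at k p y"
  by (simp add: deriv_at_def higher_pderiv_smult)

text \<open>Leibniz rule with a linear factor. For \<open>k = 0\<close> the truncated index
  \<open>k - 1\<close> is harmless because its coefficient vanishes.\<close>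

lemma higher_pderiv_X_mult:
  "(pderiv ^^ k) ([:0, 1:] * p) =
     [:0, 1:] * (pderiv ^^ k) p + smult (real k) ((pderiv ^^ (k - 1)) p)"
proof (induction k)
  case (Suc k)
  have "pderiv ([:0, 1:] * q) = q + [:0, 1:] * pderiv q" for q :: "real poly"
    by (simp add: pderiv_pCons)
  moreover have "pderiv (smult (real k) ((pderiv ^^ (k - 1)) p)) = smult (real k) ((pderiv ^^ k) p)"
    by (cases k) (simp_all add: pderiv_smult)
  ultimately show ?case
    unfolding funpow.simps o_apply Suc pderiv_add by (simp add: smult_add_left)
qed simp

lemma deriv_at_X_mult:
  "deriv_at k ([:0, 1:] * p) y = y * deriv_at k p y + real k * deriv_at (k - 1) p y"
  unfolding deriv_at_def higher_pderiv_X_mult by simp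

lemma taylor_poly_Suc:
  "poly (taylor_poly (Suc k) y f) x =
     poly (taylor_poly k y f) x + deriv_at (Suc k) f y / fact (Suc k) * (x - y) ^ Suc k"
  by (simp add: taylor_poly_def poly_sum del: power_Suc)

text \<open>The arithmetic of the induction step in \<open>laguerre_kernel_taylor\<close>, with
  \<open>M = k + 1\<close>, \<open>f\<close> the factorial of \<open>k\<close> and \<open>z\<close>
  the power of \<open>x - y\<close>; \<open>u\<close>, \<open>v\<close> are Taylor polynomials and
  \<open>p\<close>, \<open>q\<close> the next derivatives.\<close>

lemma taylor_step:
  fixes M f H u v l w p q z :: real
  assumes "M \<noteq> 0" "f \<noteq> 0"
  shows "M * (f / H * (u * l - v * w)) + z * (l * p - w * q) / H =
      M * f / H * ((u + p / (M * f) * z) * l - (v + q / (M * f) * z) * w)"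
proof -
  have *: "M * f * (r + t / (M * f) * z) = M * f * r + t * z" for r t
    using assms by (simp add: distrib_left)
  have "M * f / H * ((u + p / (M * f) * z) * l - (v + q / (M * f) * z) * w) =
      (M * f * (u + p / (M * f) * z) * l - M * f * (v + q / (M * f) * z) * w) / H"
    by (simp only: right_diff_distrib diff_divide_distrib mult.assoc times_divide_eq_left)
  then show ?thesis
    unfolding * by (simp add: algebra_simps diff_divide_distrib add_divide_distrib)
qed

section \<open>Laguerre polynomials\<close>

text \<open>Reduces additive statements about polynomials to monomials, that is, to the moments of
  the weight.\<close>

lemma poly_monom_induct [case_names monom add]:
  assumes "\<And>a n. Q (monom a n)" "\<And>p q. Q p \<Longrightarrow> Q q \<Longrightarrow> Q (p + q)"
  shows "Q (p :: 'a :: comm_monoid_add poly)"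
proof -
  have "Q (\<Sum>i\<in>A. monom (coeff p i) i)" for A
    by (induction A rule: infinite_finite_induct) (use assms assms(1)[of 0 0] in auto)
  then show ?thesis using poly_as_sum_of_monoms by metis
qed

text \<open>Carries the Gamma integral from the gauge integral over to the Lebesgue integral, which
  is possible because the integrand is nonnegative.\<close>

lemma set_integrable_Gamma:
  assumes "a > (0 :: real)"
  shows "set_integrable lborel {0<..} (\<lambda>x. x powr (a - 1) * exp (- x))"
    and "(LBINT x:{0<..}. x powr (a - 1) * exp (- x)) = Gamma a"
proof -
  let ?f = "\<lambda>x. x powr (a - 1) * exp (- x)"
  have "(?f has_integral Gamma a) {0..}"
    using Gamma_integral_real[OF assms] by (simp add: exp_minus divide_inverse)
  \<comment> \<open>The two domains differ by the null set consisting of 0.\<close>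
  then have I: "(?f has_integral Gamma a) {0<..}"
    by (subst has_integral_spike_set_eq[of _ "{0..}"])
       ((rule negligible_subset[of "{0}"]; force)+)
  then have "?f absolutely_integrable_on {0<..}"
    by (subst absolutely_integrable_on_iff_nonneg) (auto simp: has_integral_integrable)
  then show S: "set_integrable lborel {0<..} ?f"
    unfolding set_integrable_def by (subst (asm) integrable_completion) auto
  show "(LBINT x:{0<..}. ?f x) = Gamma a"
    using set_borel_integral_eq_integral(2)[OF S] I by (simp add: integral_unique)
qed

text \<open>The product depends only on \<open>f * g\<close>, so a linear functional in one argument
  carries all the analysis.\<close>

definition laguerre_functional :: "real \<Rightarrow> real poly \<Rightarrow> real" where
  "laguerre_functional \<alpha> p = (LBINT x:{0<..}. poly p x * (x powr \<alpha> * exp (- x)))"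

lemma laguerre_product_eq: "laguerre_product \<alpha> f g = laguerre_functional \<alpha> (f * g)"
  by (simp add: laguerre_product_def laguerre_functional_def)

section \<open>Moments, positivity and integration by parts for the Laguerre weight\<close>

context
  fixes \<alpha> :: real
  assumes \<alpha>: "\<alpha> > -1"
begin

lemma monom_weight:
  "x \<in> {0<..} \<Longrightarrow> poly (monom a k) x * (x powr \<alpha> * exp (- x)) =
     a * (x powr ((real k + \<alpha> + 1) - 1) * exp (- x))"
  by (simp add: poly_monom powr_add powr_realpow)

lemma monom_integrable:
  "set_integrable lborel {0<..} (\<lambda>x. poly (monom a k) x * (x powr \<alpha> * exp (- x)))"
  using set_integrable_mult_right[OF set_integrable_Gamma(1)[of "real k + \<alpha> + 1"], of a] \<alpha>
  by (subst set_integrable_cong[OF refl refl monom_weight]) auto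

lemma laguerre_functional_monom:
  "laguerre_functional \<alpha> (monom a k) = a * Gamma (real k + \<alpha> + 1)"
proof -
  have "laguerre_functional \<alpha> (monom a k) =
      (LBINT x:{0<..}. a * (x powr ((real k + \<alpha> + 1) - 1) * exp (- x)))"
    unfolding laguerre_functional_def
    by (rule set_lebesgue_integral_cong) (use monom_weight in auto)
  then show ?thesis
    using set_integrable_Gamma(2)[of "real k + \<alpha> + 1"] \<alpha> by simp
qed

lemma poly_weight_integrable:
  "set_integrable lborel {0<..} (\<lambda>x. poly p x * (x powr \<alpha> * exp (- x)))"
proof (induction p rule: poly_monom_induct)
  case (monom a n)
  then show ?case by (rule monom_integrable)
next
  case (add p q)
  then show ?case using set_integral_add(1)[OF add] by (simp add: algebra_simps)
qed

lemma laguerre_functional_add: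
  "laguerre_functional \<alpha> (p + q) = laguerre_functional \<alpha> p + laguerre_functional \<alpha> q"
  unfolding laguerre_functional_def
  using set_integral_add(2)[OF poly_weight_integrable poly_weight_integrable, of p q]
  by (simp add: algebra_simps)

lemma laguerre_functional_smult:
  "laguerre_functional \<alpha> (smult a p) = a * laguerre_functional \<alpha> p"
  by (simp add: laguerre_functional_def mult.assoc)

text \<open>If the integral were zero, \<open>p\<close> would vanish almost everywhere on the unit
  interval; its root set is finite and hence null, while the interval has positive measure.\<close>

lemma laguerre_functional_pos:
  assumes "p \<noteq> 0"
  shows "laguerre_functional \<alpha> (p * p) > 0"
proof -
  let ?f = "\<lambda>x. indicator {0<..} x *\<^sub>R (poly (p * p) x * (x powr \<alpha> * exp (- x)))"
  have int: "integrable lborel ?f"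
    using poly_weight_integrable[of "p * p"] by (simp add: set_integrable_def)
  have nn: "?f x \<ge> 0" for x by (simp add: indicator_def)
  have eq: "laguerre_functional \<alpha> (p * p) = integral\<^sup>L lborel ?f"
    by (simp add: laguerre_functional_def set_lebesgue_integral_def)
  have "integral\<^sup>L lborel ?f \<noteq> 0"
  proof
    assume "integral\<^sup>L lborel ?f = 0"
    then have "AE x in lborel. ?f x = 0"
      using integral_nonneg_eq_0_iff_AE[OF int] nn by auto
    then have "AE x in lborel. x \<notin> {0<..<1} - {x. poly p x = 0}"
      by (rule AE_mp) (auto simp: indicator_def)
    moreover have "AE x in lborel. x \<notin> {x. poly p x = 0}"
      using assms by (intro AE_not_in finite_imp_null_set_lborel poly_roots_finite)
    ultimately have "AE x in lborel. x \<notin> {0<..<1::real}"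
      by eventually_elim auto
    then have "emeasure lborel {0<..<1::real} = 0"
      by (subst (asm) AE_iff_measurable[of "{0<..<1::real}"]) auto
    then show False by simp
  qed
  moreover have "integral\<^sup>L lborel ?f \<ge> 0" using nn by simp
  ultimately show ?thesis using eq by linarith
qed

text \<open>Integration by parts against the weight, read off from the moments.\<close>

lemma laguerre_functional_pderiv:
  "laguerre_functional \<alpha> ([:0, 1:] * pderiv p) = laguerre_functional \<alpha> ([:- \<alpha> - 1, 1:] * p)"
proof (induction p rule: poly_monom_induct)
  case (monom a n)
  have 1: "[:0, 1:] * pderiv (monom a n) = monom (real n * a) n"
    by (cases n) (auto simp: pderiv_monom monom_Suc[symmetric])
  have 2: "[:- \<alpha> - 1, 1:] * monom a n = monom a (Suc n) + monom ((- \<alpha> - 1) * a) n"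
    by (simp add: monom_Suc smult_monom)
  have "Gamma (real n + \<alpha> + 1 + 1) = (real n + \<alpha> + 1) * Gamma (real n + \<alpha> + 1)"
    using \<alpha> by (intro Gamma_plus1) (auto dest: nonpos_Ints_nonpos)
  then show ?case
    unfolding 1 2 laguerre_functional_add laguerre_functional_monom by (simp add: algebra_simps)
next
  case (add p q)
  then show ?case by (simp add: pderiv_add distrib_left laguerre_functional_add del: mult_pCons_left)
qed

end

section \<open>Structure relation, three-term recurrence and norms\<close>

lemma coeff_X_mult_pderiv: "coeff ([:0, 1:] * pderiv p) k = of_nat k * coeff p k"
  for p :: "'a :: {comm_semiring_1, semiring_no_zero_divisors} poly"
  by (cases k) (simp_all add: coeff_pderiv)

lemma degree_X_mult_pderiv_le: "degree ([:0, 1:] * pderiv p) \<le> degree p"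
  for p :: "real poly"
  by (rule degree_le) (use coeff_X_mult_pderiv[of p] in \<open>auto simp: coeff_eq_0 simp del: mult_pCons_left\<close>)

lemma laguerre_inner_product: "\<alpha> > -1 \<Longrightarrow> poly_inner_product (laguerre_product \<alpha>)"
  by unfold_locales
    (auto simp: laguerre_product_eq laguerre_functional_add laguerre_functional_smult
      laguerre_functional_pos algebra_simps)

context
  fixes \<alpha> :: real
  assumes \<alpha>: "\<alpha> > -1"
begin

interpretation poly_inner_product "laguerre_product \<alpha>"
  rewrites "monic_orthogonal_poly (laguerre_product \<alpha>) \<equiv> laguerre \<alpha>"
  using laguerre_inner_product[OF \<alpha>] by (simp_all add: laguerre_def)

text \<open>The squared norm stays abstract until \<open>laguerre_norm\<close> evaluates it;
  structure relation and recurrence are first proved with ratios of norms as coefficients.\<close>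

private definition nrm :: "nat \<Rightarrow> real" where
  "nrm n = laguerre_product \<alpha> (laguerre \<alpha> n) (laguerre \<alpha> n)"

private abbreviation (input) L where "L \<equiv> laguerre \<alpha>"
private abbreviation (input) \<Phi> where "\<Phi> \<equiv> laguerre_functional \<alpha>"

private lemma nrm_pos: "nrm n > 0"
  unfolding nrm_def by (rule norm_P_pos)

lemma laguerre_eqI:
  assumes "q = 0 \<or> degree q \<le> n" "\<And>i. i \<le> n \<Longrightarrow> laguerre_product \<alpha> q (laguerre \<alpha> i) = 0"
  shows "q = 0"
  using expansion[of q "Suc n"] assms by auto

text \<open>Integration by parts for \<open>f * g\<close>: up to a multiplication operator, x d/dx
  is skew-adjoint.\<close>

lemma laguerre_product_pderiv:
  "laguerre_product \<alpha> ([:0, 1:] * pderiv f) g =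
     laguerre_product \<alpha> ([:- \<alpha> - 1, 1:] * f) g - laguerre_product \<alpha> f ([:0, 1:] * pderiv g)"
proof -
  have "\<Phi> ([:0, 1:] * pderiv (f * g)) = \<Phi> ([:0, 1:] * pderiv f * g) + \<Phi> (f * ([:0, 1:] * pderiv g))"
    by (simp add: pderiv_mult laguerre_functional_add[OF \<alpha>, symmetric] algebra_simps
        del: mult_pCons_left mult_pCons_right)
  then show ?thesis
    using laguerre_functional_pderiv[OF \<alpha>, of "f * g"]
    by (simp add: laguerre_product_eq mult.assoc del: mult_pCons_left mult_pCons_right)
qed

lemma laguerre_product_shift:
  "laguerre_product \<alpha> (r * f) g = laguerre_product \<alpha> f (r * g)"
  by (simp add: laguerre_product_eq algebra_simps del: mult_pCons_left mult_pCons_right)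

private lemma degree_linear_mult: "degree ([:a, 1:] * p) \<le> Suc (degree p)" for a :: real
  using degree_mult_le[of "[:a, 1:]" p] by simp

text \<open>The Euler operator multiplies the coefficient of x^k by k, so the difference of the
  first two terms has degree at most \<open>n\<close>. Moving the derivative onto \<open>L i\<close>
  leaves only the product with \<open>L n\<close>.\<close>

private lemma structure_nrm:
  "[:0, 1:] * pderiv (L (Suc n)) = smult (real (Suc n)) (L (Suc n)) + smult (nrm (Suc n) / nrm n) (L n)"
proof -
  define q where "q = [:0, 1:] * pderiv (L (Suc n)) - smult (real (Suc n)) (L (Suc n))
    - smult (nrm (Suc n) / nrm n) (L n)"
  have "degree ([:0, 1:] * pderiv (L (Suc n)) - smult (real (Suc n)) (L (Suc n))) \<le> n"
  proof (rule degree_le, intro allI impI)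
    fix k assume "n < k"
    then show "coeff ([:0, 1:] * pderiv (L (Suc n)) - smult (real (Suc n)) (L (Suc n))) k = 0"
      unfolding coeff_diff coeff_X_mult_pderiv coeff_smult
      by (cases "k = Suc n") (auto simp: coeff_eq_0)
  qed
  then have "degree q \<le> n"
    unfolding q_def by (rule degree_diff_le) simp
  moreover have "laguerre_product \<alpha> q (L i) = 0" if i: "i \<le> n" for i
  proof -
    have "degree ([:0, 1:] * pderiv (L i)) < Suc n"
      using degree_X_mult_pderiv_le[of "L i"] i by simp
    then have 1: "laguerre_product \<alpha> (L (Suc n)) ([:0, 1:] * pderiv (L i)) = 0"
      by (intro P_orthogonal) blast
    have 2: "laguerre_product \<alpha> (L (Suc n)) (L i) = 0"
      using i by (intro P_orthogonal) auto
    \<comment> \<open>For \<open>i = n\<close> the second factor is monic of degree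
      \<open>n + 1\<close>, so it may be replaced by \<open>L (Suc n)\<close>.\<close>
    have 3: "laguerre_product \<alpha> (L (Suc n)) ([:- \<alpha> - 1, 1:] * L i) = (if i = n then nrm (Suc n) else 0)"
    proof (cases "i = n")
      case True
      have "degree ([:- \<alpha> - 1, 1:] * L n) = Suc n"
        by (subst degree_mult_eq) auto
      moreover have "lead_coeff ([:- \<alpha> - 1, 1:] * L n) = 1"
        by (subst lead_coeff_mult) simp
      ultimately show ?thesis 
        using True inner_P_monic[of "[:- \<alpha> - 1, 1:] * L n" "Suc n"]
        by (simp add: nrm_def del: mult_pCons_left)
    next
      case False
      have "degree ([:- \<alpha> - 1, 1:] * L i) < Suc n"
        using degree_linear_mult[of "- \<alpha> - 1" "L i"] False i by (auto simp del: mult_pCons_left)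
      then show ?thesis using False P_orthogonal by auto
    qed
    have 4: "laguerre_product \<alpha> (L n) (L i) = (if i = n then nrm n else 0)"
      using i by (auto simp: nrm_def intro!: P_orthogonal)
    have "laguerre_product \<alpha> ([:0, 1:] * pderiv (L (Suc n))) (L i) = (if i = n then nrm (Suc n) else 0)"
      unfolding laguerre_product_pderiv 1 unfolding laguerre_product_shift 3 by simp
    then show ?thesis
      unfolding q_def diff_left smult_left 2 4 using nrm_pos[of n] by simp
  qed
  ultimately have "q = 0" by (intro laguerre_eqI[of q n]) auto
  then show ?thesis by (simp add: q_def algebra_simps)
qed

private definition mid :: "nat \<Rightarrow> real" where
  "mid n = laguerre_product \<alpha> ([:0, 1:] * L n) (L n) / nrm n"

text \<open>Multiplication by x is self-adjoint, so against \<open>L i\<close> the left-hand side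
  survives only for \<open>i\<close> in {n, n + 1}, once \<open>L (Suc (Suc n))\<close> is
  subtracted.\<close>

private lemma recurrence_nrm:
  "[:0, 1:] * L (Suc n) = L (Suc (Suc n)) + smult (mid (Suc n)) (L (Suc n)) + smult (nrm (Suc n) / nrm n) (L n)"
proof -
  define q where "q = [:0, 1:] * L (Suc n) - L (Suc (Suc n)) - smult (mid (Suc n)) (L (Suc n))
    - smult (nrm (Suc n) / nrm n) (L n)"
  have "[:0, 1:] * L (Suc n) \<noteq> L (Suc (Suc n)) \<Longrightarrow>
      degree ([:0, 1:] * L (Suc n) - L (Suc (Suc n))) < Suc (Suc n)"
    by (intro degree_diff_less_same_lead) (auto simp: degree_pCons_eq)
  then have "degree ([:0, 1:] * L (Suc n) - L (Suc (Suc n))) \<le> Suc n" by force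
  from degree_diff_le[OF degree_diff_le[OF this]] have "degree q \<le> Suc n"
    unfolding q_def by simp
  moreover have "laguerre_product \<alpha> q (L i) = 0" if i: "i \<le> Suc n" for i
  proof -
    have 1: "laguerre_product \<alpha> (L (Suc (Suc n))) (L i) = 0"
      using i by (intro P_orthogonal) auto
    have 2: "laguerre_product \<alpha> (L (Suc n)) (L i) = (if i = Suc n then nrm (Suc n) else 0)"
      using i by (auto simp: nrm_def intro!: P_orthogonal)
    have 3: "laguerre_product \<alpha> (L n) (L i) = (if i = n then nrm n else 0)"
      using i by (cases i n rule: linorder_cases) (auto simp: nrm_def P_orthogonal P_orthogonal')
    have 4: "laguerre_product \<alpha> ([:0, 1:] * L (Suc n)) (L i) =
        (if i = Suc n then mid (Suc n) * nrm (Suc n) else if i = n then nrm (Suc n) else 0)"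
    proof (cases "i = Suc n")
      case True
      then show ?thesis using nrm_pos[of "Suc n"] by (simp add: mid_def)
    next
      case ne: False
      show ?thesis
      proof (cases "i = n")
        case True
        have "degree ([:0, 1:] * L n) = Suc n" "lead_coeff ([:0, 1:] * L n) = 1"
          by (auto simp: degree_pCons_eq)
        then show ?thesis unfolding laguerre_product_shift
          using True inner_P_monic[of "[:0, 1:] * L n" "Suc n"]
          by (simp add: nrm_def del: mult_pCons_left)
      next
        case False
        have "degree ([:0, 1:] * L i) < Suc n"
          using degree_linear_mult[of 0 "L i"] False ne i by (auto simp del: mult_pCons_left)
        then show ?thesis unfolding laguerre_product_shift using False ne P_orthogonal by auto
      qed
    qed
    show ?thesis
      unfolding q_def diff_left smult_left 1 2 3 4 using nrm_pos[of n] by simp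
  qed
  ultimately have "q = 0" by (intro laguerre_eqI[of q "Suc n"]) auto
  then show ?thesis by (simp add: q_def algebra_simps)
qed

text \<open>The middle coefficient comes from \<open>\<Phi>(x L\<^sub>n' L\<^sub>n) = n \<parallel>L\<^sub>n\<parallel>\<^sup>2\<close>, integrated by parts.\<close>

private lemma mid_eq: "mid n = \<beta> \<alpha> n"
proof -
  have A: "laguerre_product \<alpha> ([:0, 1:] * pderiv (L n)) (L n) = real n * nrm n"
  proof (cases n)
    case 0
    then show ?thesis by simp
  next
    case (Suc m)
    then show ?thesis unfolding Suc structure_nrm add_left smult_left
      by (simp add: nrm_def P_orthogonal')
  qed
  have "[:- \<alpha> - 1, 1:] * L n = [:0, 1:] * L n - smult (\<alpha> + 1) (L n)"
    by (simp add: algebra_simps smult_diff_left smult_add_left)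
  then have "laguerre_product \<alpha> ([:- \<alpha> - 1, 1:] * L n) (L n) = (mid n - (\<alpha> + 1)) * nrm n"
    using nrm_pos[of n] by (simp only: diff_left smult_left) (simp add: mid_def nrm_def algebra_simps)
  with A laguerre_product_pderiv[of "L n" "L n"] commute[of "L n" "[:0, 1:] * pderiv (L n)"]
  have "2 * real n * nrm n = (mid n - (\<alpha> + 1)) * nrm n" by linarith
  then have "2 * real n = mid n - (\<alpha> + 1)"
    using nrm_pos[of n] by (metis mult_right_cancel less_irrefl)
  then show ?thesis by (simp add: \<beta>_def)
qed

text \<open>Both the structure relation and the recurrence determine the subleading coefficient.\<close>

private lemma nrm_ratio: "nrm (Suc n) / nrm n = \<gamma> \<alpha> (Suc n)"
proof -
  have s: "coeff (L (Suc n)) n = - (nrm (Suc n) / nrm n)" for n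
    using arg_cong[OF structure_nrm[of n], of "\<lambda>p. coeff p n"]
    unfolding coeff_X_mult_pderiv by (simp add: algebra_simps)
  have "coeff (L (Suc n)) n = - \<gamma> \<alpha> (Suc n)"
  proof (induction n)
    case 0
    have "laguerre_product \<alpha> (L (Suc 0)) (L 0) = 0" by (intro P_orthogonal) auto
    have "coeff (L 1) 0 = - mid 0"
    proof -
      have "L 1 = [:coeff (L 1) 0, 1:]"
        by (rule poly_eqI) (auto simp: coeff_pCons coeff_eq_0 split: nat.splits)
      then have "L 1 = [:0, 1:] + smult (coeff (L 1) 0) 1" by simp
      moreover have "laguerre_product \<alpha> (L 1) 1 = 0" by (intro P_orthogonal) auto
      ultimately have "laguerre_product \<alpha> [:0, 1:] 1 + coeff (L 1) 0 * laguerre_product \<alpha> 1 1 = 0"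
        by (metis add_left smult_left)
      then show ?thesis using nrm_pos[of 0] by (simp add: mid_def nrm_def field_simps)
    qed
    then show ?case by (simp add: mid_eq \<beta>_def \<gamma>_def)
  next
    case (Suc n)
    have "coeff (L (Suc n)) n = coeff (L (Suc (Suc n))) (Suc n) + mid (Suc n)"
      using arg_cong[OF recurrence_nrm[of n], of "\<lambda>p. coeff p (Suc n)"] by (simp add: coeff_eq_0)
    \<comment> \<open>The increment of \<open>\<gamma> \<alpha>\<close> from \<open>n + 1\<close> to
      \<open>n + 2\<close> is \<open>\<beta> \<alpha> (n + 1)\<close>.\<close>
    then show ?case using Suc by (simp add: mid_eq \<beta>_def \<gamma>_def algebra_simps)
  qed
  with s show ?thesis by simp
qed

lemma laguerre_structure:
  "n \<ge> 1 \<Longrightarrow> [:0, 1:] * pderiv (laguerre \<alpha> n) =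
     smult (real n) (laguerre \<alpha> n) + smult (\<gamma> \<alpha> n) (laguerre \<alpha> (n - 1))"
  using structure_nrm[of "n - 1"] nrm_ratio[of "n - 1"] by simp

lemma laguerre_recurrence:
  "n \<ge> 1 \<Longrightarrow> [:0, 1:] * laguerre \<alpha> n =
     laguerre \<alpha> (n + 1) + smult (\<beta> \<alpha> n) (laguerre \<alpha> n) + smult (\<gamma> \<alpha> n) (laguerre \<alpha> (n - 1))"
  using recurrence_nrm[of "n - 1"] nrm_ratio[of "n - 1"] by (simp add: mid_eq)

text \<open>The recurrence at index 0, stated apart because the general form refers to the index
  \<open>n - 1\<close>.\<close>

lemma laguerre_recurrence_0: "[:0, 1:] = laguerre \<alpha> 1 + [:\<beta> \<alpha> 0:]"
proof -
  have "L 1 = [:coeff (L 1) 0, 1:]"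
    by (rule poly_eqI) (auto simp: coeff_pCons coeff_eq_0 split: nat.splits)
  moreover have "coeff (L 1) 0 = - \<beta> \<alpha> 0"
    using arg_cong[OF structure_nrm[of 0], of "\<lambda>p. coeff p 0"] nrm_ratio[of 0]
    unfolding coeff_X_mult_pderiv by (simp add: \<beta>_def \<gamma>_def)
  ultimately show ?thesis by simp
qed

lemma \<gamma>_pos: "n \<ge> 1 \<Longrightarrow> \<gamma> \<alpha> n > 0"
  using \<alpha> by (simp add: \<gamma>_def)

lemma h_pos: "h \<alpha> n > 0"
  using \<alpha> by (simp add: h_def Gamma_real_pos)

lemma h_Suc: "h \<alpha> (Suc n) = \<gamma> \<alpha> (Suc n) * h \<alpha> n"
proof -
  have "Gamma (real n + \<alpha> + 1 + 1) = (real n + \<alpha> + 1) * Gamma (real n + \<alpha> + 1)"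
    using \<alpha> by (intro Gamma_plus1) (auto dest: nonpos_Ints_nonpos)
  then show ?thesis by (simp add: h_def \<gamma>_def algebra_simps)
qed

text \<open>Both sides satisfy the same first-order recursion and start at the zeroth moment of the
  weight.\<close>

lemma laguerre_norm: "laguerre_product \<alpha> (laguerre \<alpha> n) (laguerre \<alpha> n) = h \<alpha> n"
proof -
  have "nrm n = h \<alpha> n"
  proof (induction n)
    case 0
    have "nrm 0 = \<Phi> (monom 1 0)" by (simp add: nrm_def laguerre_product_eq)
    then show ?case unfolding laguerre_functional_monom[OF \<alpha>] by (simp add: h_def)
  next
    case (Suc n)
    then show ?case using nrm_ratio[of n] nrm_pos[of n] h_Suc[of n] by (simp add: field_simps)
  qed
  then show ?thesis by (simp add: nrm_def)
qed

text \<open>Reflects that consecutive Laguerre polynomials are coprime: running the recurrence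
  downwards carries divisibility to \<open>p * laguerre \<alpha> 0\<close>, which is
  \<open>p\<close>.\<close>

lemma dvd_of_dvd_mult_consecutive_laguerre:
  "r dvd p * laguerre \<alpha> (Suc n) \<Longrightarrow> r dvd p * laguerre \<alpha> n \<Longrightarrow> r dvd p"
proof (induction n)
  case (Suc n)
  have "L n = smult (1 / \<gamma> \<alpha> (Suc n))
      ([:- \<beta> \<alpha> (Suc n), 1:] * L (Suc n) - L (Suc (Suc n)))"
    using laguerre_recurrence[of "Suc n"] \<gamma>_pos[of "Suc n"] by simp
  then have "p * L n = smult (1 / \<gamma> \<alpha> (Suc n))
      ([:- \<beta> \<alpha> (Suc n), 1:] * (p * L (Suc n)) - p * L (Suc (Suc n)))"
    by (simp only: mult_smult_right right_diff_distrib mult.left_commute)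
  then have "r dvd p * L n" using Suc.prems by (metis dvd_diff dvd_mult dvd_smult)
  then show ?case using Suc by blast
qed simp

text \<open>The recurrence replaces the polynomial of index \<open>n - 2\<close> in the structure
  relation at \<open>n - 1\<close>. There is no such index for \<open>n = 1\<close>, which is
  checked directly.\<close>

lemma laguerre_structure_pred:
  assumes "n \<ge> 1"
  shows "[:0, 1:] * pderiv (laguerre \<alpha> (n - 1)) =
    - laguerre \<alpha> n - [:real n + \<alpha>, -1:] * laguerre \<alpha> (n - 1)"
proof (cases "n = 1")
  case True
  have "laguerre \<alpha> 1 = [:0, 1:] - [:\<beta> \<alpha> 0:]"
    using laguerre_recurrence_0 by (metis add_diff_cancel_right')
  then show ?thesis using True by (simp add: \<beta>_def)
next
  case False
  then have n: "n - 1 \<ge> 1" using assms by simp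
  have "[:real n + \<alpha>, -1:] = smult (\<beta> \<alpha> (n - 1) - real (n - 1)) 1 - [:0, 1:]"
    using assms by (simp add: \<beta>_def of_nat_diff)
  moreover have "laguerre \<alpha> n = [:0, 1:] * laguerre \<alpha> (n - 1)
      - smult (\<beta> \<alpha> (n - 1)) (laguerre \<alpha> (n - 1)) - smult (\<gamma> \<alpha> (n - 1)) (laguerre \<alpha> (n - 1 - 1))"
    using laguerre_recurrence[OF n] assms by (simp del: mult_pCons_left)
  ultimately show ?thesis
    unfolding laguerre_structure[OF n]
    by (simp only: left_diff_distrib smult_diff_left mult_smult_left mult_1_left)
qed

text \<open>Solving the recurrence for the polynomial of index \<open>n - 2\<close> explains the
  form of \<open>V2\<close>, \<open>W2\<close>, \<open>V3\<close>, \<open>W3\<close>;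
  \<open>n \<ge> 2\<close> keeps the divisor positive.\<close>

lemma laguerre_index_shift:
  assumes "n \<ge> 2"
  shows "a * laguerre \<alpha> (n - 1) + b * laguerre \<alpha> (n - 1 - 1) =
    (- smult (1 / \<gamma> \<alpha> (n - 1)) b) * laguerre \<alpha> n +
    (a + b * smult (1 / \<gamma> \<alpha> (n - 1)) [:- \<beta> \<alpha> (n - 1), 1:]) * laguerre \<alpha> (n - 1)"
proof (rule poly_eq_poly_eq_iff[THEN iffD1], rule ext)
  fix x
  have n: "n - 1 \<ge> 1" "n - 1 + 1 = n" using assms by auto
  have g: "\<gamma> \<alpha> (n - 1) > 0" using \<gamma>_pos[OF n(1)] .
  have "x * poly (laguerre \<alpha> (n - 1)) x = poly (laguerre \<alpha> n) x
      + \<beta> \<alpha> (n - 1) * poly (laguerre \<alpha> (n - 1)) x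
      + \<gamma> \<alpha> (n - 1) * poly (laguerre \<alpha> (n - 1 - 1)) x"
    using arg_cong[OF laguerre_recurrence[OF n(1)], of "\<lambda>p. poly p x"] n(2) by simp
  then have *: "poly (laguerre \<alpha> (n - 1 - 1)) x =
      ((x - \<beta> \<alpha> (n - 1)) * poly (laguerre \<alpha> (n - 1)) x - poly (laguerre \<alpha> n) x) / \<gamma> \<alpha> (n - 1)"
    using g by (simp add: field_simps)
  show "poly (a * laguerre \<alpha> (n - 1) + b * laguerre \<alpha> (n - 1 - 1)) x =
    poly ((- smult (1 / \<gamma> \<alpha> (n - 1)) b) * laguerre \<alpha> n +
    (a + b * smult (1 / \<gamma> \<alpha> (n - 1)) [:- \<beta> \<alpha> (n - 1), 1:]) * laguerre \<alpha> (n - 1)) x"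
    unfolding poly_add poly_mult *
    by (simp add: diff_divide_distrib add_divide_distrib algebra_simps)
qed

section \<open>The Christoffel--Darboux formula with derivatives\<close>

text \<open>Evaluation at y in the classical formula is replaced by a linear functional
  \<open>D\<close>, so that derivatives at y are covered as well. For evaluation at y the bracket
  becomes \<open>(x - y) * poly (L i) y\<close>.\<close>

lemma christoffel_darboux_functional:
  fixes D :: "real poly \<Rightarrow> real"
  assumes add: "\<And>p q. D (p + q) = D p + D q" and smult: "\<And>a p. D (smult a p) = a * D p"
  shows "(\<Sum>i\<le>n. (x * D (L i) - D ([:0, 1:] * L i)) * poly (L i) x / h \<alpha> i) =
    (poly (L (Suc n)) x * D (L n) - poly (L n) x * D (L (Suc n))) / h \<alpha> n"
proof (induction n)
  case 0
  have e: "[:0, 1:] = L 1 + smult (\<beta> \<alpha> 0) 1"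
    using laguerre_recurrence_0 by simp
  have "D [:0, 1:] = D (L 1) + \<beta> \<alpha> 0 * D 1"
    by (subst e) (simp only: add smult)
  moreover have "poly (L 1) x = x - \<beta> \<alpha> 0"
    using arg_cong[OF e, of "\<lambda>p. poly p x"] by simp
  ultimately have "x * D 1 - D [:0, 1:] = poly (L 1) x * D 1 - D (L 1)"
    by (simp only: left_diff_distrib)
  then show ?case by simp
next
  case (Suc n)
  let ?g = "\<gamma> \<alpha> (Suc n)" and ?b = "\<beta> \<alpha> (Suc n)"
  have e: "[:0, 1:] * L (Suc n) = L (Suc (Suc n)) + smult ?b (L (Suc n)) + smult ?g (L n)"
    using laguerre_recurrence[of "Suc n"] by simp
  have "D ([:0, 1:] * L (Suc n)) = D (L (Suc (Suc n))) + ?b * D (L (Suc n)) + ?g * D (L n)"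
    unfolding e add smult ..
  moreover have "x * poly (L (Suc n)) x =
      poly (L (Suc (Suc n))) x + ?b * poly (L (Suc n)) x + ?g * poly (L n) x"
    using arg_cong[OF e, of "\<lambda>p. poly p x"] by simp
  ultimately have "(x * D (L (Suc n)) - D ([:0, 1:] * L (Suc n))) * poly (L (Suc n)) x =
      poly (L (Suc (Suc n))) x * D (L (Suc n)) - poly (L (Suc n)) x * D (L (Suc (Suc n)))
      - ?g * (poly (L (Suc n)) x * D (L n) - poly (L n) x * D (L (Suc n)))"
    by algebra
  moreover have "h \<alpha> (Suc n) = ?g * h \<alpha> n" "?g > 0" "h \<alpha> n > 0"
    using h_Suc \<gamma>_pos h_pos by auto
  \<comment> \<open>Since \<open>h \<alpha> (Suc n) = ?g * h \<alpha> n\<close>, the correction term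
    is exactly the previous right-hand side and the sum telescopes.\<close>
  ultimately have "(x * D (L (Suc n)) - D ([:0, 1:] * L (Suc n))) * poly (L (Suc n)) x / h \<alpha> (Suc n) =
      (poly (L (Suc (Suc n))) x * D (L (Suc n)) - poly (L (Suc n)) x * D (L (Suc (Suc n)))) / h \<alpha> (Suc n)
      - (poly (L (Suc n)) x * D (L n) - poly (L n) x * D (L (Suc n))) / h \<alpha> n"
    by (simp add: diff_divide_distrib[of _ "?g * _"] del: mult_pCons_left)
  then show ?case
    unfolding sum.atMost_Suc Suc by linarith
qed

text \<open>The \<open>k\<close>-th derivative in \<open>y\<close> of the reproducing kernel for
  polynomials of degree below \<open>n\<close>.\<close>

definition laguerre_kernel :: "nat \<Rightarrow> nat \<Rightarrow> real \<Rightarrow> real \<Rightarrow> real" where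
  "laguerre_kernel n k x y = (\<Sum>i<n. deriv_at k (L i) y * poly (L i) x / h \<alpha> i)"

text \<open>Christoffel-Darboux for the \<open>k\<close>-th derivative at \<open>y\<close>; the
  Leibniz rule produces the kernel of order \<open>k - 1\<close>.\<close>

lemma laguerre_kernel_step:
  assumes "n \<ge> 1"
  shows "(x - y) * laguerre_kernel n k x y = real k * laguerre_kernel n (k - 1) x y +
    (poly (L n) x * deriv_at k (L (n - 1)) y - poly (L (n - 1)) x * deriv_at k (L n) y) / h \<alpha> (n - 1)"
proof -
  have n: "{..<n} = {..n - 1}" using assms by auto
  have "(x - y) * laguerre_kernel n k x y - real k * laguerre_kernel n (k - 1) x y =
      (\<Sum>i\<le>n - 1. (x * deriv_at k (L i) y - deriv_at k ([:0, 1:] * L i) y) * poly (L i) x / h \<alpha> i)"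
    unfolding laguerre_kernel_def n sum_distrib_left deriv_at_X_mult sum_subtractf[symmetric]
    by (intro sum.cong refl) (simp add: algebra_simps diff_divide_distrib add_divide_distrib)
  then show ?thesis
    using christoffel_darboux_functional[of "\<lambda>p. deriv_at k p y" x "n - 1"] assms
    by (simp add: deriv_at_add deriv_at_smult del: mult_pCons_left)
qed

text \<open>Iterating \<open>laguerre_kernel_step\<close> adds one Taylor term per step, and the
  factors \<open>k + 1\<close> build up the factorial.\<close>

lemma laguerre_kernel_taylor:
  assumes "n \<ge> 1"
  shows "(x - y) ^ (k + 1) * laguerre_kernel n k x y = fact k / h \<alpha> (n - 1) *
    (poly (taylor_poly k y (L (n - 1))) x * poly (L n) x
     - poly (taylor_poly k y (L n)) x * poly (L (n - 1)) x)"
proof (induction k)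
  case 0
  then show ?case using laguerre_kernel_step[OF assms, of x y 0]
    by (simp add: taylor_poly_def mult.commute)
next
  case (Suc k)
  let ?H = "h \<alpha> (n - 1)" and ?z = "(x - y) ^ Suc k"
  have "(x - y) ^ (Suc k + 1) * laguerre_kernel n (Suc k) x y =
      ?z * ((x - y) * laguerre_kernel n (Suc k) x y)"
    by (simp add: algebra_simps)
  also have "\<dots> = real (Suc k) * (?z * laguerre_kernel n k x y) +
      ?z * (poly (L n) x * deriv_at (Suc k) (L (n - 1)) y
        - poly (L (n - 1)) x * deriv_at (Suc k) (L n) y) / ?H"
    unfolding laguerre_kernel_step[OF assms] by (simp add: distrib_left mult_ac del: power_Suc of_nat_Suc)
  also have "?z * laguerre_kernel n k x y = fact k / ?H *
    (poly (taylor_poly k y (L (n - 1))) x * poly (L n) x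
     - poly (taylor_poly k y (L n)) x * poly (L (n - 1)) x)"
    using Suc by simp
  finally have "(x - y) ^ (Suc k + 1) * laguerre_kernel n (Suc k) x y =
      of_nat (Suc k) * (fact k / ?H *
        (poly (taylor_poly k y (L (n - 1))) x * poly (L n) x
         - poly (taylor_poly k y (L n)) x * poly (L (n - 1)) x)) +
      ?z * (poly (L n) x * deriv_at (Suc k) (L (n - 1)) y
        - poly (L (n - 1)) x * deriv_at (Suc k) (L n) y) / ?H" .
  also have "\<dots> = fact (Suc k) / ?H *
    (poly (taylor_poly (Suc k) y (L (n - 1))) x * poly (L n) x
     - poly (taylor_poly (Suc k) y (L n)) x * poly (L (n - 1)) x)"
    unfolding taylor_poly_Suc fact_Suc
    by (intro taylor_step) simp_all
  finally show ?case .
qed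

end

section \<open>Degrees and leading coefficients\<close>

text \<open>A degree bound together with the coefficient at the bound, which may be 0. This passes
  through sums and products even when terms cancel; the exact degree is recovered at the end from a
  nonzero coefficient.\<close>

definition has_top :: "'a :: idom poly \<Rightarrow> nat \<Rightarrow> 'a \<Rightarrow> bool" where
  "has_top p n a \<longleftrightarrow> degree p \<le> n \<and> coeff p n = a"

lemma has_top_add: "has_top p n a \<Longrightarrow> has_top q n b \<Longrightarrow> has_top (p + q) n (a + b)"
  by (auto simp: has_top_def degree_add_le)

lemma has_top_diff: "has_top p n a \<Longrightarrow> has_top q n b \<Longrightarrow> has_top (p - q) n (a - b)"
  by (auto simp: has_top_def degree_diff_le)

lemma has_top_uminus: "has_top p n a \<Longrightarrow> has_top (- p) n (- a)"
  by (auto simp: has_top_def)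

lemma has_top_smult: "has_top p n a \<Longrightarrow> has_top (smult b p) n (b * a)"
  by (auto simp: has_top_def)

lemma has_top_raise: "has_top p m a \<Longrightarrow> m < n \<Longrightarrow> has_top p n 0"
  by (auto simp: has_top_def coeff_eq_0)

lemma has_top_mult:
  assumes "has_top p m a" "has_top q n b"
  shows "has_top (p * q) (m + n) (a * b)"
proof -
  have le: "degree p \<le> m" "degree q \<le> n" using assms by (auto simp: has_top_def)
  have "coeff (p * q) (m + n) = coeff p m * coeff q n"
  proof (cases "degree p = m \<and> degree q = n")
    case True
    then show ?thesis using coeff_mult_degree_sum[of p q] by simp
  next
    case False
    then have "degree p + degree q < m + n" using le by linarith
    then have "degree (p * q) < m + n" using degree_mult_le[of p q] by linarith
    moreover have "coeff p m * coeff q n = 0"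
      using False le by (auto simp: coeff_eq_0)
    ultimately show ?thesis by (simp add: coeff_eq_0)
  qed
  then show ?thesis using assms le degree_mult_le[of p q] by (auto simp: has_top_def)
qed

lemma has_top_sum:
  "(\<And>i. i \<in> A \<Longrightarrow> has_top (f i) n (a i)) \<Longrightarrow> has_top (\<Sum>i\<in>A. f i) n (\<Sum>i\<in>A. a i)"
  by (induction A rule: infinite_finite_induct) (auto simp: has_top_add, auto simp: has_top_def)

lemma has_top_pderiv: "has_top p n a \<Longrightarrow> has_top (pderiv p) n 0" for p :: "real poly"
  by (auto simp: has_top_def coeff_pderiv degree_pderiv coeff_eq_0)

lemma has_top_X_mult_pderiv:
  "has_top p n a \<Longrightarrow> has_top ([:0, 1:] * pderiv p) n (real n * a)" for p :: "real poly"
  unfolding has_top_def coeff_X_mult_pderiv using degree_X_mult_pderiv_le[of p] order.trans by blast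

lemma has_top_linear: "has_top [:a, b:] 1 b"
  by (simp add: has_top_def)

lemma has_top_eq: "has_top p m a \<Longrightarrow> m = n \<Longrightarrow> a = b \<Longrightarrow> has_top p n b"
  by simp

lemma has_top_DgCo: "has_top p n a \<Longrightarrow> a \<noteq> 0 \<Longrightarrow> DgCo p = (n, a)"
  unfolding has_top_def DgCo_def by (metis le_antisym le_degree)

lemma has_top_monic: "lead_coeff p = 1 \<Longrightarrow> has_top p (degree p) 1"
  by (simp add: has_top_def)

lemma has_top_taylor_poly: "has_top (taylor_poly k y f) k (deriv_at k f y / fact k)"
proof -
  have p: "has_top ([:- y, 1:] ^ m) m 1" for m
  proof -
    have "lead_coeff ([:- y, 1:] ^ m) = 1" by (subst lead_coeff_power) simp
    then show ?thesis using degree_linear_power[of "- y" m] by (simp add: has_top_def)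
  qed
  have "taylor_poly k y f =
      (\<Sum>m<k. smult (deriv_at m f y / fact m) ([:- y, 1:] ^ m)) +
      smult (deriv_at k f y / fact k) ([:- y, 1:] ^ k)"
    by (simp add: taylor_poly_def lessThan_Suc_atMost[symmetric])
  moreover have "has_top (\<Sum>m<k. smult (deriv_at m f y / fact m) ([:- y, 1:] ^ m)) k (\<Sum>m<k. 0)"
    by (intro has_top_sum has_top_raise[OF has_top_smult[OF p]]) auto
  ultimately show ?thesis
    using has_top_add has_top_smult[OF p[of k], of "deriv_at k f y / fact k"] by fastforce
qed

section \<open>Sobolev orthogonal polynomials\<close>

text \<open>Differentiate the first equation and multiply by \<open>q\<^sub>0 * q\<^sub>1\<close>;
  the second equation then removes \<open>pderiv g\<close> and the first removes \<open>g\<close>,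
  without any division.\<close>

lemma eliminate_second_order:
  fixes f g q\<^sub>0 q\<^sub>1 q\<^sub>2 q\<^sub>3 q\<^sub>4 :: "'a :: idom poly"
  assumes 1: "q\<^sub>0 * pderiv f + q\<^sub>2 * f = q\<^sub>1 * g"
    and 2: "q\<^sub>0 * pderiv g + q\<^sub>3 * g = q\<^sub>4 * f"
  shows "(q\<^sub>1 * q\<^sub>0 ^ 2) * pderiv (pderiv f)
      + q\<^sub>0 * (q\<^sub>1 * q\<^sub>2 + q\<^sub>1 * q\<^sub>3 + pderiv q\<^sub>0 * q\<^sub>1 - q\<^sub>0 * pderiv q\<^sub>1) * pderiv f
      + (q\<^sub>1 * q\<^sub>2 * q\<^sub>3 + q\<^sub>0 * (pderiv q\<^sub>2 * q\<^sub>1 - q\<^sub>2 * pderiv q\<^sub>1) - q\<^sub>4 * q\<^sub>1 ^ 2) * f = 0"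
proof -
  have "pderiv q\<^sub>0 * pderiv f + q\<^sub>0 * pderiv (pderiv f) + pderiv q\<^sub>2 * f + q\<^sub>2 * pderiv f =
      pderiv q\<^sub>1 * g + q\<^sub>1 * pderiv g"
    using arg_cong[OF 1, of pderiv] by (simp add: pderiv_mult pderiv_add algebra_simps)
  with 1 2 show ?thesis by algebra
qed

text \<open>Cramer's rule for the system expressing \<open>r f\<close> and \<open>r g\<close> through \<open>l\<close> and \<open>m\<close>.\<close>

lemma cramer_derivative:
  fixes r r' x f f' g l m :: "'a :: idom"
  assumes "r \<noteq> 0"
    and "r * f = a\<^sub>1 * l + b\<^sub>1 * m" "r * g = a\<^sub>2 * l + b\<^sub>2 * m"
    and "x * (r' * f + r * f') = a\<^sub>3 * l + b\<^sub>3 * m"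
    and "a\<^sub>1 * b\<^sub>2 - a\<^sub>2 * b\<^sub>1 = r * e"
  shows "x * (a\<^sub>1 * b\<^sub>2 - a\<^sub>2 * b\<^sub>1) * f' + (x * r' * e + b\<^sub>3 * a\<^sub>2 - a\<^sub>3 * b\<^sub>2) * f =
    (b\<^sub>3 * a\<^sub>1 - a\<^sub>3 * b\<^sub>1) * g"
proof -
  have "r * (x * (a\<^sub>1 * b\<^sub>2 - a\<^sub>2 * b\<^sub>1) * f' + (x * r' * e + b\<^sub>3 * a\<^sub>2 - a\<^sub>3 * b\<^sub>2) * f) =
      r * ((b\<^sub>3 * a\<^sub>1 - a\<^sub>3 * b\<^sub>1) * g)"
    using assms(2-5) by algebra
  then show ?thesis using assms(1) by simp
qed

section \<open>The connection formula and the ladder equations\<close>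

context
  fixes \<alpha> :: real and N :: nat and c :: "nat \<Rightarrow> real" and d :: "nat \<Rightarrow> nat"
    and lam :: "nat \<Rightarrow> nat \<Rightarrow> real"
  assumes \<alpha>: "\<alpha> > -1"
begin

private abbreviation (input) "Lag \<equiv> laguerre \<alpha>"
private abbreviation (input) "Sn \<equiv> S \<alpha> N c d lam"
private abbreviation (input) "I \<equiv> I_plus N d lam"
private abbreviation (input) "R \<equiv> rho N c d"
private abbreviation (input) "F \<equiv> F2 \<alpha> N c d lam"
private abbreviation (input) "G \<equiv> G2 \<alpha> N c d lam"
private abbreviation (input) "F' \<equiv> F3 \<alpha> N c d lam"
private abbreviation (input) "G' \<equiv> G3 \<alpha> N c d lam"
private abbreviation (input) "V \<equiv> V2 \<alpha> N c d lam"
private abbreviation (input) "W \<equiv> W2 \<alpha> N c d lam"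
private abbreviation (input) "V' \<equiv> V3 \<alpha> N c d lam"
private abbreviation (input) "W' \<equiv> W3 \<alpha> N c d lam"
private abbreviation (input) "Dl \<equiv> Delta \<alpha> N c d lam"
private abbreviation (input) "dl \<equiv> delta \<alpha> N c d lam"
private abbreviation (input) "s \<equiv> \<sigma> \<alpha> N c d lam"

lemma sobolev_inner_product: "poly_inner_product (sobolev_product \<alpha> N c d lam)"
proof -
  interpret Lg: poly_inner_product "laguerre_product \<alpha>" by (rule laguerre_inner_product[OF \<alpha>])
  show ?thesis
  proof
    fix p q r :: "real poly" and a :: real
    show "sobolev_product \<alpha> N c d lam (p + q) r =
        sobolev_product \<alpha> N c d lam p r + sobolev_product \<alpha> N c d lam q r"
      by (simp add: sobolev_product_def Lg.add_left deriv_at_add algebra_simps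
          case_prod_unfold sum.distrib)
    show "sobolev_product \<alpha> N c d lam (smult a p) q = a * sobolev_product \<alpha> N c d lam p q"
      by (simp add: sobolev_product_def Lg.smult_left deriv_at_smult algebra_simps
          case_prod_unfold sum_distrib_left)
    show "sobolev_product \<alpha> N c d lam p q = sobolev_product \<alpha> N c d lam q p"
      by (simp add: sobolev_product_def Lg.commute[of p q] algebra_simps)
    assume "p \<noteq> 0"
    moreover have "(\<Sum>(j, k)\<in>I. lam j k * deriv_at k p (c j) * deriv_at k p (c j)) \<ge> 0"
      by (intro sum_nonneg) (auto simp: I_plus_def mult.assoc)
    ultimately show "sobolev_product \<alpha> N c d lam p p > 0"
      unfolding sobolev_product_def using Lg.pos[of p] by linarith
  qed
qed

interpretation Lg: poly_inner_product "laguerre_product \<alpha>"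
  rewrites "monic_orthogonal_poly (laguerre_product \<alpha>) \<equiv> Lag"
  using laguerre_inner_product[OF \<alpha>] by (simp_all add: laguerre_def)

interpretation Sb: poly_inner_product "sobolev_product \<alpha> N c d lam"
  rewrites "monic_orthogonal_poly (sobolev_product \<alpha> N c d lam) \<equiv> Sn"
  using sobolev_inner_product by (simp_all add: S_def)

text \<open>Both polynomials are monic, so the Sobolev product of \<open>Sn n\<close> and
  \<open>Lag n\<close> is the squared Sobolev norm of \<open>Sn n\<close>, while its integral part
  is \<open>h \<alpha> n\<close>. Dividing by \<open>h \<alpha> (n - 1)\<close> gives the
  claim.\<close>

lemma \<gamma>_plus_\<sigma>_pos:
  assumes "n \<ge> 1"
  shows "\<gamma> \<alpha> n + s n > 0"
proof -
  let ?T = "\<Sum>(j, k)\<in>I. lam j k * deriv_at k (Sn n) (c j) * deriv_at k (Lag n) (c j)"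
  have "sobolev_product \<alpha> N c d lam (Sn n) (Lag n) = laguerre_product \<alpha> (Sn n) (Lag n) + ?T"
    by (simp add: sobolev_product_def)
  moreover have "sobolev_product \<alpha> N c d lam (Sn n) (Lag n) = sobolev_product \<alpha> N c d lam (Sn n) (Sn n)"
    by (rule Sb.inner_P_monic) auto
  moreover have "laguerre_product \<alpha> (Sn n) (Lag n) = h \<alpha> n"
    using Lg.inner_P_monic[of "Sn n" n] Lg.commute laguerre_norm[OF \<alpha>] by simp
  ultimately have "h \<alpha> n + ?T > 0" using Sb.norm_P_pos[of n] by simp
  moreover have "h \<alpha> n = \<gamma> \<alpha> n * h \<alpha> (n - 1)" using h_Suc[OF \<alpha>, of "n - 1"] assms by simp
  moreover have "s n = ?T / h \<alpha> (n - 1)" by (simp add: \<sigma>_def)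
  ultimately have "(\<gamma> \<alpha> n + s n) * h \<alpha> (n - 1) > 0"
    using h_pos[OF \<alpha>, of "n - 1"] by (simp add: distrib_right)
  then show ?thesis using h_pos[OF \<alpha>, of "n - 1"] by (simp add: zero_less_mult_iff)
qed

text \<open>For \<open>i < n\<close>, Sobolev orthogonality to \<open>Lag i\<close> turns the
  Laguerre coefficient of the difference into minus the discrete part.\<close>

lemma S_kernel_expansion:
  "poly (Sn n) x = poly (Lag n) x -
     (\<Sum>(j, k)\<in>I. lam j k * deriv_at k (Sn n) (c j) * laguerre_kernel \<alpha> n k x (c j))"
proof -
  let ?D = "Sn n - Lag n"
  have coef: "laguerre_product \<alpha> ?D (Lag i) =
      - (\<Sum>(j, k)\<in>I. lam j k * deriv_at k (Sn n) (c j) * deriv_at k (Lag i) (c j))" if "i < n" for i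
    using Sb.P_orthogonal[of "Lag i" n] Lg.P_orthogonal[of "Lag i" n] that
    by (simp add: Lg.diff_left sobolev_product_def)
  have "?D = 0 \<or> degree ?D < n"
    using degree_diff_less_same_lead[of "Sn n" n "Lag n"] by auto
  from Lg.expansion[OF this] have
    "?D = (\<Sum>i<n. smult (laguerre_product \<alpha> ?D (Lag i) / h \<alpha> i) (Lag i))"
    unfolding laguerre_norm[OF \<alpha>] .
  then have "poly ?D x = poly (\<Sum>i<n. smult (laguerre_product \<alpha> ?D (Lag i) / h \<alpha> i) (Lag i)) x"
    by (rule arg_cong)
  also have "\<dots> = (\<Sum>i<n. laguerre_product \<alpha> ?D (Lag i) / h \<alpha> i * poly (Lag i) x)"
    by (simp add: poly_sum)
  also have "\<dots> = - (\<Sum>i<n. \<Sum>(j, k)\<in>I.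
      lam j k * deriv_at k (Sn n) (c j) * (deriv_at k (Lag i) (c j) * poly (Lag i) x / h \<alpha> i))"
    unfolding sum_negf[symmetric]
    by (intro sum.cong refl)
       (simp add: coef sum_negf sum_divide_distrib sum_distrib_left case_prod_unfold mult_ac)
  also have "\<dots> = - (\<Sum>(j, k)\<in>I. lam j k * deriv_at k (Sn n) (c j) * laguerre_kernel \<alpha> n k x (c j))"
    \<comment> \<open>Summing over the Laguerre index first assembles the kernels.\<close>
    by (subst sum.swap) (simp add: laguerre_kernel_def[OF \<alpha>] sum_distrib_left case_prod_unfold)
  finally show ?thesis by simp
qed

lemma rho_quot_mult:
  assumes "(j, k) \<in> I"
  shows "R = rho_quot N c d j k * [:- c j, 1:] ^ (k + 1)"
proof -
  have "[:- c j, 1:] ^ (k + 1) dvd [:- c j, 1:] ^ (d j + 1)"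
    using assms by (intro le_imp_power_dvd) (auto simp: I_plus_def)
  also have "\<dots> dvd R" unfolding rho_def
    using assms by (intro dvd_prodI) (auto simp: I_plus_def)
  finally show ?thesis unfolding rho_quot_def by (simp del: power_Suc)
qed

text \<open>Multiplying the kernel expansion by \<open>R\<close> supplies each kernel with the power
  of \<open>x - c j\<close> that \<open>laguerre_kernel_taylor\<close> requires.\<close>

lemma rho_mult_S:
  assumes "n \<ge> 1"
  shows "R * Sn n = F n * Lag n + G n * Lag (n - 1)"
proof (rule poly_eq_poly_eq_iff[THEN iffD1], rule ext)
  fix x
  define a where "a j k = fact k * lam j k * deriv_at k (Sn n) (c j) / h \<alpha> (n - 1)" for j k
  define t where "t j k m = poly (taylor_poly k (c j) (Lag m)) x * poly (rho_quot N c d j k) x" for j k m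
  have F: "poly (F n) x = poly R x - (\<Sum>(j, k)\<in>I. a j k * t j k (n - 1))"
    by (simp add: F2_def poly_sum case_prod_unfold a_def t_def)
  have G: "poly (G n) x = (\<Sum>(j, k)\<in>I. a j k * t j k n)"
    by (simp add: G2_def poly_sum case_prod_unfold a_def t_def)
  have *: "poly R x * (lam j k * deriv_at k (Sn n) (c j) * laguerre_kernel \<alpha> n k x (c j)) =
      a j k * t j k (n - 1) * poly (Lag n) x - a j k * t j k n * poly (Lag (n - 1)) x"
    if "(j, k) \<in> I" for j k
  proof -
    have "poly R x = poly (rho_quot N c d j k) x * (x - c j) ^ (k + 1)"
      by (subst rho_quot_mult[OF that]) (simp del: power_Suc)
    then have "poly R x * (lam j k * deriv_at k (Sn n) (c j) * laguerre_kernel \<alpha> n k x (c j)) =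
        poly (rho_quot N c d j k) x * lam j k * deriv_at k (Sn n) (c j) *
          ((x - c j) ^ (k + 1) * laguerre_kernel \<alpha> n k x (c j))"
      by (simp add: mult_ac del: power_Suc)
    also have "\<dots> = a j k * t j k (n - 1) * poly (Lag n) x - a j k * t j k n * poly (Lag (n - 1)) x"
      unfolding laguerre_kernel_taylor[OF \<alpha> assms]
      by (simp add: a_def t_def algebra_simps diff_divide_distrib)
    finally show ?thesis .
  qed
  have "poly (R * Sn n) x = poly R x * poly (Lag n) x -
      (\<Sum>(j, k)\<in>I. poly R x * (lam j k * deriv_at k (Sn n) (c j) * laguerre_kernel \<alpha> n k x (c j)))"
    by (simp add: S_kernel_expansion[of n x] algebra_simps sum_distrib_left case_prod_unfold)
  also have "(\<Sum>(j, k)\<in>I. poly R x * (lam j k * deriv_at k (Sn n) (c j) * laguerre_kernel \<alpha> n k x (c j))) =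
      (\<Sum>(j, k)\<in>I. a j k * t j k (n - 1) * poly (Lag n) x - a j k * t j k n * poly (Lag (n - 1)) x)"
    using * by (intro sum.cong) auto
  finally show "poly (R * Sn n) x = poly (F n * Lag n + G n * Lag (n - 1)) x"
    by (simp add: F G algebra_simps sum_subtractf sum_distrib_left case_prod_unfold)
qed

text \<open>The Euler operator applied to \<open>rho_mult_S\<close>; the two structure relations
  keep the result in terms of \<open>Lag n\<close> and \<open>Lag (n - 1)\<close>.\<close>

lemma X_mult_pderiv_rho_mult_S:
  assumes "n \<ge> 1"
  shows "[:0, 1:] * (pderiv R * Sn n + R * pderiv (Sn n)) = F' n * Lag n + G' n * Lag (n - 1)"
proof -
  let ?X = "[:0, 1:] :: real poly"
  have "?X * (pderiv R * Sn n + R * pderiv (Sn n)) = ?X * pderiv (R * Sn n)"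
    by (simp add: pderiv_mult add.commute mult.commute)
  also have "\<dots> = ?X * pderiv (F n) * Lag n + F n * (?X * pderiv (Lag n))
      + ?X * pderiv (G n) * Lag (n - 1) + G n * (?X * pderiv (Lag (n - 1)))"
    unfolding rho_mult_S[OF assms] pderiv_add pderiv_mult by algebra
  also have "\<dots> = F' n * Lag n + G' n * Lag (n - 1)"
    unfolding laguerre_structure[OF \<alpha> assms] laguerre_structure_pred[OF \<alpha> assms] F3_def G3_def
    by (simp add: algebra_simps del: mult_pCons_left mult_pCons_right)
  finally show ?thesis .
qed

lemma rho_monic: "lead_coeff R = 1"
  unfolding rho_def lead_coeff_prod lead_coeff_power by simp

lemma degree_rho: "degree R = deg_rho N d"
  unfolding rho_def deg_rho_def
proof (subst degree_prod_sum_eq)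
  fix j
  have "[:- c j, 1:] \<noteq> 0" by simp
  then show "[:- c j, 1:] ^ (d j + 1) \<noteq> 0" by (rule power_not_zero)
qed (simp only: degree_linear_power)

lemma rho_nonzero: "R \<noteq> 0"
  using rho_monic by force

lemma rho_mult_S_pred:
  assumes "n \<ge> 2"
  shows "R * Sn (n - 1) = V n * Lag n + W n * Lag (n - 1)"
    and "[:0, 1:] * (pderiv R * Sn (n - 1) + R * pderiv (Sn (n - 1))) = V' n * Lag n + W' n * Lag (n - 1)"
proof -
  have n: "n - 1 \<ge> 1" using assms by simp
  show "R * Sn (n - 1) = V n * Lag n + W n * Lag (n - 1)"
    unfolding rho_mult_S[OF n] V2_def W2_def by (rule laguerre_index_shift[OF \<alpha> assms])
  show "[:0, 1:] * (pderiv R * Sn (n - 1) + R * pderiv (Sn (n - 1))) = V' n * Lag n + W' n * Lag (n - 1)"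
    unfolding X_mult_pderiv_rho_mult_S[OF n] V3_def W3_def by (rule laguerre_index_shift[OF \<alpha> assms])
qed

text \<open>Solving the system for \<open>R * Sn n\<close> and \<open>R * Sn (n - 1)\<close> shows
  that \<open>R\<close> divides the determinant times \<open>Lag n\<close> and times
  \<open>Lag (n - 1)\<close>.\<close>

lemma rho_mult_delta:
  assumes "n \<ge> 2"
  shows "Dl n = R * dl n"
proof -
  have S: "R * Sn n = F n * Lag n + G n * Lag (n - 1)"
    using rho_mult_S[of n] assms by simp
  note T = rho_mult_S_pred(1)[OF assms]
  have "Dl n * Lag n = R * (W n * Sn n - G n * Sn (n - 1))"
    unfolding Delta_def using S T by algebra
  moreover have "Dl n * Lag (n - 1) = R * (F n * Sn (n - 1) - V n * Sn n)"
    unfolding Delta_def using S T by algebra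
  ultimately have "R dvd Dl n"
    using dvd_of_dvd_mult_consecutive_laguerre[OF \<alpha>, of R "Dl n" "n - 1"] assms by simp
  then show ?thesis by (simp add: delta_def)
qed

lemma ladder_equations:
  assumes "n \<ge> 2"
  shows "q0 \<alpha> N c d lam n * pderiv (Sn n) + q2 \<alpha> N c d lam n * Sn n = q1 \<alpha> N c d lam n * Sn (n - 1)"
    and "q0 \<alpha> N c d lam n * pderiv (Sn (n - 1)) + q3 \<alpha> N c d lam n * Sn (n - 1) = q4 \<alpha> N c d lam n * Sn n"
proof -
  have n: "n \<ge> 1" using assms by simp
  note S = rho_mult_S[OF n] X_mult_pderiv_rho_mult_S[OF n]
  note T = rho_mult_S_pred[OF assms]
  have D: "F n * W n - V n * G n = R * dl n"
    using rho_mult_delta[OF assms] by (simp add: Delta_def)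
  show "q0 \<alpha> N c d lam n * pderiv (Sn n) + q2 \<alpha> N c d lam n * Sn n = q1 \<alpha> N c d lam n * Sn (n - 1)"
    unfolding q0_def q1_def q2_def Delta_def
    by (rule cramer_derivative[OF rho_nonzero S(1) T(1) S(2) D])
  \<comment> \<open>The second equation is the first with \<open>Sn n\<close>,
    \<open>Sn (n - 1)\<close> and \<open>Lag n\<close>, \<open>Lag (n - 1)\<close> both
    interchanged, so the determinant keeps its sign.\<close>
  have T1: "R * Sn (n - 1) = W n * Lag (n - 1) + V n * Lag n"
    and S1: "R * Sn n = G n * Lag (n - 1) + F n * Lag n"
    and T2: "[:0, 1:] * (pderiv R * Sn (n - 1) + R * pderiv (Sn (n - 1))) = W' n * Lag (n - 1) + V' n * Lag n"
    and D1: "W n * F n - G n * V n = R * dl n"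
    using S(1) T D by (simp_all only: add.commute mult.commute)
  show "q0 \<alpha> N c d lam n * pderiv (Sn (n - 1)) + q3 \<alpha> N c d lam n * Sn (n - 1) = q4 \<alpha> N c d lam n * Sn n"
    unfolding q0_def q3_def q4_def Delta_def
    using cramer_derivative[OF rho_nonzero T1 S1 T2 D1]
    by (simp only: mult.commute[of "F n"] mult.commute[of "V n" "G n"])
qed

lemma S_differential_equation:
  assumes "n \<ge> 2"
  shows "P2 \<alpha> N c d lam n * pderiv (pderiv (Sn n)) + P1 \<alpha> N c d lam n * pderiv (Sn n)
    + P0 \<alpha> N c d lam n * Sn n = 0"
  unfolding P2_def P1_def P0_def
  by (rule eliminate_second_order[OF ladder_equations[OF assms]])

section \<open>Leading coefficients of the polynomials in the ladder and differential
  equations\<close>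

context
  assumes N: "N \<ge> 1"
begin

private abbreviation (input) "D \<equiv> deg_rho N d"

lemma deg_rho_pos: "D \<ge> 1"
proof -
  have "D \<ge> (\<Sum>j=1..N. 1)" unfolding deg_rho_def by (intro sum_mono) simp
  then show ?thesis using N by simp
qed

lemma rho_top: "has_top R D 1"
  using has_top_monic[OF rho_monic] degree_rho by simp

lemma rho_quot_top:
  assumes "(j, k) \<in> I"
  shows "k + 1 \<le> D" "has_top (rho_quot N c d j k) (D - (k + 1)) 1"
proof -
  let ?q = "rho_quot N c d j k" and ?l = "[:- c j, 1:] ^ (k + 1)"
  note eq = rho_quot_mult[OF assms]
  have l: "degree ?l = k + 1" by (rule degree_linear_power)
  have l': "lead_coeff ?l = 1" by (subst lead_coeff_power) simp
  have nz: "?q \<noteq> 0" "?l \<noteq> 0" using rho_nonzero eq by auto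
  have "D = degree ?q + (k + 1)"
    unfolding degree_rho[symmetric] by (subst eq) (simp only: degree_mult_eq[OF nz] l)
  moreover have "lead_coeff (?q * ?l) = 1" using rho_monic unfolding eq[symmetric] .
  then have "lead_coeff ?q = 1" unfolding lead_coeff_mult l' by (simp only: mult_1_right)
  ultimately show "k + 1 \<le> D" "has_top ?q (D - (k + 1)) 1"
    using has_top_monic by auto
qed

lemma taylor_mult_rho_quot_top:
  assumes "(j, k) \<in> I"
  shows "has_top (taylor_poly k (c j) f * rho_quot N c d j k) (D - 1) (deriv_at k f (c j) / fact k)"
  by (rule has_top_eq[OF has_top_mult[OF has_top_taylor_poly rho_quot_top(2)[OF assms]]])
     (use rho_quot_top(1)[OF assms] in auto)

text \<open>The factorial in each weight cancels the one in the top Taylor coefficient, which leaves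
  the sum defining \<open>\<sigma>\<close>.\<close>

lemma G2_top: "has_top (G n) (D - 1) (s n)"
proof -
  have "has_top (G n) (D - 1) (\<Sum>(j, k)\<in>I. fact k * lam j k * deriv_at k (Sn n) (c j) / h \<alpha> (n - 1)
      * (deriv_at k (Lag n) (c j) / fact k))"
    unfolding G2_def case_prod_unfold
    by (intro has_top_sum has_top_smult taylor_mult_rho_quot_top) auto
  then show ?thesis
    by (simp add: \<sigma>_def sum_divide_distrib case_prod_unfold mult.assoc)
qed

lemma G2_top0: "has_top (G n) D 0"
  using has_top_raise[OF G2_top] deg_rho_pos by simp

text \<open>The sum subtracted from \<open>R\<close> has degree at most \<open>D - 1\<close>, so
  \<open>R\<close> alone determines the top coefficient.\<close>

lemma F2_top: "has_top (F n) D 1"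
proof -
  have "has_top (R - F n) (D - 1) (\<Sum>(j, k)\<in>I. fact k * lam j k * deriv_at k (Sn n) (c j) / h \<alpha> (n - 1)
      * (deriv_at k (Lag (n - 1)) (c j) / fact k))"
    unfolding F2_def case_prod_unfold diff_diff_eq2 add_diff_cancel_left'
    by (intro has_top_sum has_top_smult taylor_mult_rho_quot_top) auto
  then have "has_top (R - F n) D 0"
    by (rule has_top_raise) (use deg_rho_pos in simp)
  from has_top_diff[OF rho_top this] show ?thesis by simp
qed

lemma F3_top: "has_top (F' n) D (real D + real n)"
  unfolding F3_def
  by (rule has_top_eq[OF has_top_diff[OF has_top_add[OF has_top_X_mult_pderiv[OF F2_top]
        has_top_smult[OF F2_top]] G2_top0]]) auto

text \<open>In degree \<open>D\<close>, \<open>F n\<close> contributes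
  \<open>\<gamma> \<alpha> n\<close> and the product of x with \<open>G n\<close> contributes
  \<open>s n\<close>.\<close>

lemma G3_top: "has_top (G' n) D (\<gamma> \<alpha> n + s n)"
proof -
  have "has_top ([:real n + \<alpha>, -1:] * G n) D (- s n)"
    by (rule has_top_eq[OF has_top_mult[OF has_top_linear G2_top]]) (use deg_rho_pos in auto)
  from has_top_diff[OF has_top_add[OF has_top_X_mult_pderiv[OF G2_top0] has_top_smult[OF F2_top]] this]
  show ?thesis unfolding G3_def by (rule has_top_eq) auto
qed

context
  fixes n :: nat
  assumes n: "n \<ge> 2"
begin

text \<open>\<open>A\<close> becomes the top coefficient of \<open>W2\<close>, \<open>Delta\<close>
  and \<open>q0\<close>, and \<open>B\<close> that of \<open>q1\<close>.\<close>

private definition "A = 1 + s (n - 1) / \<gamma> \<alpha> (n - 1)"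
private definition "B = \<gamma> \<alpha> n + s n"

private lemma \<gamma>_pred: "\<gamma> \<alpha> (n - 1) > 0"
  using \<gamma>_pos[OF \<alpha>] n by simp

private lemma A_pos: "A > 0"
proof -
  have "A = (\<gamma> \<alpha> (n - 1) + s (n - 1)) / \<gamma> \<alpha> (n - 1)"
    using \<gamma>_pred by (simp add: A_def add_divide_distrib)
  then show ?thesis using \<gamma>_pred \<gamma>_plus_\<sigma>_pos[of "n - 1"] n by simp
qed

private lemma B_pos: "B > 0"
  unfolding B_def using \<gamma>_plus_\<sigma>_pos[of n] n by simp

private lemma linear_top: "has_top (smult (1 / \<gamma> \<alpha> (n - 1)) [:- \<beta> \<alpha> (n - 1), 1:]) 1 (1 / \<gamma> \<alpha> (n - 1))"
  using has_top_smult[OF has_top_linear[of "- \<beta> \<alpha> (n - 1)" 1], of "1 / \<gamma> \<alpha> (n - 1)"]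
  by (simp only: mult_1_right)

private lemma V2_top: "has_top (V n) D 0"
  using has_top_uminus[OF has_top_smult[OF G2_top0]] by (simp add: V2_def)

private lemma V3_top: "has_top (V' n) D (- A)"
  unfolding V3_def
  by (rule has_top_eq[OF has_top_uminus[OF has_top_smult[OF G3_top]]])
     (use \<gamma>_pred in \<open>auto simp: A_def add_divide_distrib\<close>)

private lemma W2_top: "has_top (W n) D A"
  unfolding W2_def
  by (rule has_top_eq[OF has_top_add[OF F2_top has_top_eq[OF has_top_mult[OF G2_top linear_top] _ refl]]])
     (use deg_rho_pos in \<open>auto simp: A_def\<close>)

private lemma W3_top: "has_top (W' n) (D + 1) A"
  unfolding W3_def
  by (rule has_top_eq[OF has_top_add[OF has_top_raise[OF F3_top] has_top_mult[OF G3_top linear_top]]])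
     (use \<gamma>_pred in \<open>auto simp: A_def add_divide_distrib\<close>)

private lemma Delta_top: "has_top (Dl n) (D + D) A"
  unfolding Delta_def
  using has_top_diff[OF has_top_mult[OF F2_top W2_top] has_top_mult[OF V2_top G2_top0]] by simp

text \<open>As \<open>A\<close> is nonzero, the degree of \<open>Dl n\<close> is exact, and dividing
  by the monic \<open>R\<close> preserves the leading coefficient.\<close>

private lemma delta_top: "has_top (dl n) D A"
proof -
  have "degree (Dl n) = D + D" "lead_coeff (Dl n) = A"
    using has_top_DgCo[OF Delta_top] A_pos by (auto simp: DgCo_def)
  moreover have "dl n \<noteq> 0"
    using rho_mult_delta[OF n] calculation A_pos by force
  ultimately have "degree (dl n) = D" "lead_coeff (dl n) = A"
    using degree_mult_eq[OF rho_nonzero, of "dl n"] degree_rho rho_monic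
      lead_coeff_mult[of R "dl n"] unfolding rho_mult_delta[OF n] by auto
  then show ?thesis by (auto simp: has_top_def)
qed

private abbreviation (input) "Q0 \<equiv> q0 \<alpha> N c d lam n"
private abbreviation (input) "Q1 \<equiv> q1 \<alpha> N c d lam n"
private abbreviation (input) "Q2 \<equiv> q2 \<alpha> N c d lam n"
private abbreviation (input) "Q3 \<equiv> q3 \<alpha> N c d lam n"
private abbreviation (input) "Q4 \<equiv> q4 \<alpha> N c d lam n"

private lemma q0_top: "has_top Q0 (2 * D + 1) A"
  unfolding q0_def
  by (rule has_top_eq[OF has_top_mult[OF has_top_linear Delta_top]]) auto

private lemma q1_top: "has_top Q1 (2 * D) B"
  unfolding q1_def
  by (rule has_top_eq[OF has_top_diff[OF has_top_mult[OF G3_top F2_top] has_top_mult[OF F3_top G2_top0]]])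
     (auto simp: B_def)

private lemma rho_delta_top: "has_top ([:0, 1:] * pderiv R * dl n) (D + D) (real D * A)"
  by (rule has_top_eq[OF has_top_mult[OF has_top_X_mult_pderiv[OF rho_top] delta_top]]) auto

text \<open>The contribution \<open>real D * A\<close> from the derivative of \<open>R\<close>
  cancels against part of \<open>F' n * W n\<close>, leaving only the term with
  \<open>n\<close>.\<close>

private lemma q2_top: "has_top Q2 (2 * D) (- (real n * A))"
  unfolding q2_def
  by (rule has_top_eq[OF has_top_diff[OF has_top_add[OF rho_delta_top has_top_mult[OF G3_top V2_top]]
        has_top_mult[OF F3_top W2_top]]])
     (auto simp: algebra_simps)

private lemma q3_top: "has_top Q3 (2 * D + 1) (- A)"
proof -
  have "has_top (V' n * G n) (2 * D + 1) 0"
    by (rule has_top_raise[OF has_top_mult[OF V3_top G2_top0]]) simp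
  moreover have "has_top ([:0, 1:] * pderiv R * dl n) (2 * D + 1) 0"
    by (rule has_top_raise[OF rho_delta_top]) simp
  moreover have "has_top (W' n * F n) (2 * D + 1) A"
    by (rule has_top_eq[OF has_top_mult[OF W3_top F2_top]]) auto
  ultimately show ?thesis
    unfolding q3_def using has_top_diff[OF has_top_add] by fastforce
qed

text \<open>Here the cruder bound on the degree of \<open>V2\<close> would not suffice: the degree of \<open>W3\<close> exceeds that of \<open>rho\<close>.\<close>

private lemma q4_top: "\<exists>a. has_top Q4 (2 * D) a"
proof -
  have V: "has_top (V n) (D - 1) (- (1 / \<gamma> \<alpha> (n - 1) * s (n - 1)))"
    unfolding V2_def by (intro has_top_uminus has_top_smult G2_top)
  have "has_top (W' n * V n) (2 * D) (A * - (1 / \<gamma> \<alpha> (n - 1) * s (n - 1)))"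
    by (rule has_top_eq[OF has_top_mult[OF W3_top V]]) (use deg_rho_pos in auto)
  moreover have "has_top (V' n * W n) (2 * D) (- A * A)"
    by (rule has_top_eq[OF has_top_mult[OF V3_top W2_top]]) auto
  ultimately show ?thesis unfolding q4_def using has_top_diff by blast
qed

lemma P2_top: "has_top (P2 \<alpha> N c d lam n) (6 * D + 2) (B * A\<^sup>2)"
  unfolding P2_def power2_eq_square
  by (rule has_top_eq[OF has_top_mult[OF q1_top has_top_mult[OF q0_top q0_top]]]) auto

text \<open>In the bracket only \<open>Q1 * Q3\<close> reaches degree \<open>4 * D + 1\<close>; each
  derivative lowers the degree enough to give 0 there.\<close>

lemma P1_top: "has_top (P1 \<alpha> N c d lam n) (6 * D + 2) (- B * A\<^sup>2)"
proof -
  let ?m = "4 * D + 1"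
  have "has_top (Q1 * Q2) ?m 0"
    by (rule has_top_raise[OF has_top_mult[OF q1_top q2_top]]) simp
  moreover have "has_top (Q1 * Q3) ?m (- (B * A))"
    by (rule has_top_eq[OF has_top_mult[OF q1_top q3_top]]) auto
  moreover have "has_top (pderiv Q0 * Q1) ?m 0"
    by (rule has_top_eq[OF has_top_mult[OF has_top_pderiv[OF q0_top] q1_top]]) auto
  moreover have "has_top (Q0 * pderiv Q1) ?m 0"
    by (rule has_top_eq[OF has_top_mult[OF q0_top has_top_pderiv[OF q1_top]]]) auto
  ultimately have "has_top (Q1 * Q2 + Q1 * Q3 + pderiv Q0 * Q1 - Q0 * pderiv Q1) ?m (0 + - (B * A) + 0 - 0)"
    by (intro has_top_diff has_top_add)
  from has_top_mult[OF q0_top this] show ?thesis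
    unfolding P1_def by (rule has_top_eq) (auto simp: power2_eq_square)
qed

text \<open>Only \<open>Q1 * Q2 * Q3\<close> contributes in degree \<open>6 * D + 1\<close>; for
  \<open>Q4\<close> a degree bound suffices.\<close>

lemma P0_top: "has_top (P0 \<alpha> N c d lam n) (6 * D + 1) (real n * B * A\<^sup>2)"
proof -
  let ?m = "6 * D + 1"
  obtain a where q4: "has_top Q4 (2 * D) a" using q4_top by blast
  have "has_top (Q1 * Q2 * Q3) ?m (real n * B * A\<^sup>2)"
    by (rule has_top_eq[OF has_top_mult[OF has_top_mult[OF q1_top q2_top] q3_top]])
       (auto simp: power2_eq_square)
  moreover have "has_top (Q0 * (pderiv Q2 * Q1 - Q2 * pderiv Q1)) ?m 0"
    by (rule has_top_eq[OF has_top_mult[OF q0_top has_top_diff[OF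
          has_top_mult[OF has_top_pderiv[OF q2_top] q1_top]
          has_top_mult[OF q2_top has_top_pderiv[OF q1_top]]]]]) auto
  moreover have "has_top (Q4 * Q1\<^sup>2) ?m 0"
    unfolding power2_eq_square
    by (rule has_top_raise[OF has_top_mult[OF q4 has_top_mult[OF q1_top q1_top]]]) simp
  ultimately have "has_top (P0 \<alpha> N c d lam n) ?m (real n * B * A\<^sup>2 + 0 - 0)"
    unfolding P0_def by (intro has_top_diff has_top_add)
  then show ?thesis by simp
qed

lemma DgCo_P:
  "DgCo (P2 \<alpha> N c d lam n) = (6 * D + 2, (\<gamma> \<alpha> n + s n) * (1 + s (n - 1) / \<gamma> \<alpha> (n - 1)) ^ 2)"
  "DgCo (P1 \<alpha> N c d lam n) = (6 * D + 2, - (\<gamma> \<alpha> n + s n) * (1 + s (n - 1) / \<gamma> \<alpha> (n - 1)) ^ 2)"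
  "DgCo (P0 \<alpha> N c d lam n) = (6 * D + 1, real n * (\<gamma> \<alpha> n + s n) * (1 + s (n - 1) / \<gamma> \<alpha> (n - 1)) ^ 2)"
  using A_pos B_pos n
    has_top_DgCo[OF P2_top] has_top_DgCo[OF P1_top] has_top_DgCo[OF P0_top]
  unfolding A_def B_def by auto

end

end

end

theorem theorem2:
  fixes \<alpha> :: real and N :: nat and c :: "nat \<Rightarrow> real" and d :: "nat \<Rightarrow> nat"
    and lam :: "nat \<Rightarrow> nat \<Rightarrow> real" and n :: nat
  assumes "\<alpha> > -1"
    and "N \<ge> 1"
    and "\<forall>j\<in>{1..N}. c j < 0"
    and "inj_on c {1..N}"
    and "mono_on {1..N} d"
    and "\<forall>j\<in>{1..N}. \<forall>k\<le>d j. lam j k \<ge> 0"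
    and "\<forall>j\<in>{1..N}. lam j (d j) > 0"
    and "n \<ge> 2"
  shows
    "(\<forall>x. poly (P2 \<alpha> N c d lam n) x * poly (pderiv (pderiv (S \<alpha> N c d lam n))) x
        + poly (P1 \<alpha> N c d lam n) x * poly (pderiv (S \<alpha> N c d lam n)) x
        + poly (P0 \<alpha> N c d lam n) x * poly (S \<alpha> N c d lam n) x = 0)
     \<and> DgCo (P2 \<alpha> N c d lam n) =
         (6 * deg_rho N d + 2,
          (\<gamma> \<alpha> n + \<sigma> \<alpha> N c d lam n)
            * (1 + \<sigma> \<alpha> N c d lam (n - 1) / \<gamma> \<alpha> (n - 1)) ^ 2)
     \<and> DgCo (P1 \<alpha> N c d lam n) =
         (6 * deg_rho N d + 2,
          - (\<gamma> \<alpha> n + \<sigma> \<alpha> N c d lam n)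
            * (1 + \<sigma> \<alpha> N c d lam (n - 1) / \<gamma> \<alpha> (n - 1)) ^ 2)
     \<and> DgCo (P0 \<alpha> N c d lam n) =
         (6 * deg_rho N d + 1,
          real n * (\<gamma> \<alpha> n + \<sigma> \<alpha> N c d lam n)
            * (1 + \<sigma> \<alpha> N c d lam (n - 1) / \<gamma> \<alpha> (n - 1)) ^ 2)"
proof -
  note \<alpha> = assms(1) and N = assms(2) and n = assms(8)
  have "poly (P2 \<alpha> N c d lam n) x * poly (pderiv (pderiv (S \<alpha> N c d lam n))) x
      + poly (P1 \<alpha> N c d lam n) x * poly (pderiv (S \<alpha> N c d lam n)) x
      + poly (P0 \<alpha> N c d lam n) x * poly (S \<alpha> N c d lam n) x = 0" for x
    using arg_cong[OF S_differential_equation[OF \<alpha> n], of "\<lambda>p. poly p x"]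
    by (simp only: poly_add poly_mult poly_0)
  then show ?thesis using DgCo_P[OF \<alpha> N n] by blast
qed

end
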